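(* Let $G$ be a compact Lie group and let $T$ be a coupling tree. For $i=1,2,3$, let $\alpha_i$ be a labelling of $T$ with underlying highest weight labelling $x\mapsto\lambda_i^x$ and underlying multiplicity counter labelling $x\mapsto k_i^x$. Let $\underline k$ be an assignment of a positive integer $k^y$ to every leaf $y$ of $T$ and let $k$ be a positive integer. Then $$R(T)^{\alpha_1\alpha_2,k}_{\alpha_3,\underline k}=\sum\ \prod_{x\text{ node of }T}\begin{pmatrix}\lambda_1^{x'}&\lambda_1^{x''}&\lambda_1^x&k_1^x\\ \lambda_2^{x'}&\lambda_2^{x''}&\lambda_2^x&k_2^x\\ \lambda_3^{x'}&\lambda_3^{x''}&\lambda_3^x&k_3^x\\ k^{x'}&k^{x''}&k^x&\end{pmatrix},$$ where $x',x''$ denote the child vertices of $x$, $k^x=k$ in case $x$ is the root of $T$, and the sum is over all assignments of an integer $k^x\in\{1,\dots,m_{(\lambda_1^x,\lambda_2^x)}(\lambda_3^x)\}$ to every internal node $x$ of $T$ (nodes different from the root); for a leaf $y$, $k^y$ is the integer prescribed by $\underline k$.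
   Context: Representations. $G$ is a compact Lie group; $\widehat G$ is the set of isomorphism classes of finite-dimensional irreps of $G$, labelled by highest weights $\lambda$. For every $\lambda\in\widehat G$ a concrete unitary irrep $(H_\lambda,D^\lambda)$ is fixed, with an orthonormal weight basis $|\lambda\mu\rangle$, $\mu\in\mathtt w(\lambda)$ (a finite index set of weight labels). For $\underline\lambda=(\lambda^1,\dots,\lambda^N)\in\widehat G^N$ put $H_{\underline\lambda}=\bigotimes_{i}H_{\lambda^i}$, with the diagonal $G$-representation. For $\lambda_1,\lambda_2\in\widehat G$, $m_{(\lambda_1,\lambda_2)}(\lambda)$ is the multiplicity of $D^\lambda$ in $D^{\lambda_1}\otimes D^{\lambda_2}$ and $\langle\langle\lambda_1,\lambda_2\rangle\rangle=\{(\lambda,k):m_{(\lambda_1,\lambda_2)}(\lambda)>0,\ 1\le k\le m_{(\lambda_1,\lambda_2)}(\lambda)\}$. For every pair $(\lambda_1,\lambda_2)$ a unitary $G$-isomorphism $H_{\lambda_1}\otimes H_{\lambda_2}\cong\bigoplus_{(\lambda,k)\in\langle\langle\lambda_1,\lambda_2\rangle\rangle}H_\lambda$ is fixed once and for all; $\mathrm i_{(\lambda_1,\lambda_2),\lambda,k}:H_\lambda\to H_{\lambda_1}\otimes H_{\lambda_2}$ are the corresponding isometric injections. Coupling trees. A coupling tree $T$ with $N\geq 2$ leaves is an ordered rooted binary tree: every non-leaf vertex (node) $x$ has exactly two ordered children $x',x''$; the root is a node, and the nodes different from the root are called internal. A labelling $\alpha$ of $T$ (always assumed admissible) assigns to each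 leaf $y$ some $\lambda^y\in\widehat G$ and to each node $x$ a pair $\alpha^x=(\lambda^x,k^x)\in\langle\langle\lambda^{x'},\lambda^{x''}\rangle\rangle$; $x\mapsto\lambda^x$ and $x\mapsto k^x$ are the underlying highest weight and multiplicity counter labellings. $\mathcal L^T(\underline\lambda,\lambda)$ is the set of labellings with leaf labels $\underline\lambda$ (in leaf order) and root highest weight $\lambda$. For $\alpha\in\mathcal L^T(\underline\lambda,\lambda)$ the $G$-equivariant isometric injection $\mathrm i_\alpha^T:H_\lambda\to H_{\underline\lambda}$ is defined recursively: if the children $\mathtt r',\mathtt r''$ of the root $\mathtt r$ are the roots of subtrees $S',S''$ with restricted labellings $\alpha',\alpha''$, and $\alpha^{\mathtt r}=(\lambda,k)$, then $\mathrm i_\alpha^T=(\mathrm i_{\alpha'}^{S'}\otimes\mathrm i_{\alpha''}^{S''})\circ\mathrm i_{(\lambda^{\mathtt r'},\lambda^{\mathtt r''}),\lambda,k}$, with $\mathrm i=\mathrm{id}$ for a one-vertex tree. Put $|T;\alpha,\mu\rangle=\mathrm i_\alpha^T|\lambda\mu\rangle$. Recoupling coefficients. Let $T_1,T_2$ be coupling trees with labellings $\alpha_i\in\mathcal L^{T_i}(\underline\lambda_i,\lambda)$, where $\underline\lambda_2$ arises from $\underline\lambda_1$ by a permutation, and let $\Pi:H_{\underline\lambda_1}\to H_{\underline\lambda_2}$ be the unitary permuting the tensor factors accordingly. By Schur's lemma $R(T_2|T_1)^{\alpha_2}_{\alpha_1}:=\langle T_2;\alpha_2,\mu|\Pi|T_1;\alpha_1,\mu\rangle$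 does not depend on $\mu\in\mathtt w(\lambda)$. Tree operations. The join $T\cdot T$ is the coupling tree with $2N$ leaves having a new root whose left and right subtrees are copies of $T$; given labellings $\alpha_1,\alpha_2$ of $T$ with root weights $\lambda_1,\lambda_2$ and $(\lambda,k)\in\langle\langle\lambda_1,\lambda_2\rangle\rangle$, $[\alpha_1\cdot\alpha_2,(\lambda,k)]$ is the labelling of $T\cdot T$ which is $\alpha_1$ on the first copy, $\alpha_2$ on the second copy and $(\lambda,k)$ on the new root. The leaf duplication $T^\vee$ replaces every leaf $y$ of $T$ by a node with two leaf children. Given labellings $\alpha_1,\alpha_2,\alpha_3$ of $T$ and an assignment $\underline k=(k^y)$ of positive integers to the leaves with $(\lambda_3^y,k^y)\in\langle\langle\lambda_1^y,\lambda_2^y\rangle\rangle$ for all leaves $y$, $[\alpha_1*\alpha_2,\alpha_3,\underline k]$ is the labelling of $T^\vee$ assigning $\lambda_1^y,\lambda_2^y$ to the left and right leaf attached at $y$, $(\lambda_3^y,k^y)$ to the node replacing $y$, and $\alpha_3^x$ to each node $x$ of $T$. Below, $\Pi$ identifies the factor $H_{\lambda_i^y}$ in one tensor product with the factor $H_{\lambda_i^y}$ in the other. Write $(\alpha_3,\underline k,k)\in\langle\langle\alpha_1,\alpha_2\rangle\rangle$ if $(\lambda_3^y,k^y)\in\langle\langle\lambda_1^y,\lambda_2^y\rangle\rangle$ for all leaves $y$ and $(\lambda_3^{\mathtt r},k)\in\langle\langle\lambda_1^{\mathtt r},\lambda_2^{\mathtt r}\rangle\rangle$ for the root $\mathtt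 r$. In that case $$R(T)^{\alpha_1\alpha_2,k}_{\alpha_3,\underline k}:=R(T\cdot T|T^\vee)^{[\alpha_1\cdot\alpha_2,(\lambda_3^{\mathtt r},k)]}_{[\alpha_1*\alpha_2,\alpha_3,\underline k]},$$ and it is set to $0$ otherwise. $9\lambda$ symbols. Let $\boldsymbol\vee$ be the cherry (the coupling tree with two leaves). For $i=1,2,3$ let $\alpha_i$ be the labelling of $\boldsymbol\vee$ with leaf labels $\lambda_i^1,\lambda_i^2$ and root label $(\lambda_i,k_i)$, and let $\underline k=(k^1,k^2)$, $k$ be positive integers. Then $$\begin{pmatrix}\lambda_1^1&\lambda_1^2&\lambda_1&k_1\\ \lambda_2^1&\lambda_2^2&\lambda_2&k_2\\ \lambda_3^1&\lambda_3^2&\lambda_3&k_3\\ k^1&k^2&k&\end{pmatrix}:=R(\boldsymbol\vee)^{\alpha_1\alpha_2,k}_{\alpha_3,\underline k},$$ and the symbol is set to $0$ if $(\lambda_i,k_i)\notin\langle\langle\lambda_i^1,\lambda_i^2\rangle\rangle$ for some $i$. *)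

theory Defs
  imports "HOL-Analysis.Analysis" "HOL-Algebra.Group" "HOL-Combinatorics.Permutations"
begin

section \<open>Compact Lie groups\<close>

primrec Ck_on :: "nat \<Rightarrow> 'a::real_normed_vector set \<Rightarrow> ('a \<Rightarrow> 'b::real_normed_vector) \<Rightarrow> bool" where
  "Ck_on 0 S f \<longleftrightarrow> continuous_on S f"
| "Ck_on (Suc n) S f \<longleftrightarrow>
     (\<forall>x\<in>S. f differentiable (at x)) \<and> (\<forall>v. Ck_on n S (\<lambda>x. frechet_derivative f (at x) v))"

text \<open>Only used for open sets.\<close>
definition smooth_on :: "'a::real_normed_vector set \<Rightarrow> ('a \<Rightarrow> 'b::real_normed_vector) \<Rightarrow> bool" where
  "smooth_on S f \<longleftrightarrow> (\<forall>n. Ck_on n S f)"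

text \<open>A chart is a pair of its domain and the coordinate map. The model space is an arbitrary
  finite-dimensional real normed space; class \<open>euclidean_space\<close> would exclude dimension 0,
  that is, the finite groups.\<close>

definition smooth_manifold :: "'p topology \<Rightarrow> ('p set \<times> ('p \<Rightarrow> 'e::real_normed_vector)) set \<Rightarrow> bool" where
  "smooth_manifold X A \<longleftrightarrow>
     (\<exists>B::'e set. finite B \<and> span B = UNIV) \<and>
     Hausdorff_space X \<and> second_countable X \<and>
     \<Union> (fst ` A) = topspace X \<and>
     (\<forall>(U, \<phi>)\<in>A. openin X U \<and> open (\<phi> ` U) \<and>
        homeomorphic_map (subtopology X U) (top_of_set (\<phi> ` U)) \<phi>) \<and>
     (\<forall>(U, \<phi>)\<in>A. \<forall>(V, \<psi>)\<in>A. smooth_on (\<phi> ` (U \<inter> V)) (\<lambda>a. \<psi> (inv_into U \<phi> a)))"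

record ('g, 'e) lie_data = "'g monoid" +
  lie_top :: "'g topology"
  lie_atlas :: "('g set \<times> ('g \<Rightarrow> 'e)) set"

locale compact_lie_group = group G
  for G :: "('g, 'e::real_normed_vector, 'm) lie_data_scheme" (structure) +
  assumes topspace_eq: "topspace (lie_top G) = carrier G"
    and manifold: "smooth_manifold (lie_top G) (lie_atlas G)"
    and compact: "compact_space (lie_top G)"
    and continuous_mult:
      "continuous_map (prod_topology (lie_top G) (lie_top G)) (lie_top G) (\<lambda>(g, h). g \<otimes> h)"
    and continuous_inverse: "continuous_map (lie_top G) (lie_top G) (\<lambda>g. inv g)"
    and smooth_mult:
      "\<lbrakk>(U, \<phi>) \<in> lie_atlas G; (V, \<psi>) \<in> lie_atlas G; (W, \<theta>) \<in> lie_atlas G\<rbrakk> \<Longrightarrow>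
       smooth_on {(a, b). a \<in> \<phi> ` U \<and> b \<in> \<psi> ` V \<and> inv_into U \<phi> a \<otimes> inv_into V \<psi> b \<in> W}
                 (\<lambda>(a, b). \<theta> (inv_into U \<phi> a \<otimes> inv_into V \<psi> b))"
    and smooth_inverse:
      "\<lbrakk>(U, \<phi>) \<in> lie_atlas G; (W, \<theta>) \<in> lie_atlas G\<rbrakk> \<Longrightarrow>
       smooth_on {a \<in> \<phi> ` U. inv (inv_into U \<phi> a) \<in> W} (\<lambda>a. \<theta> (inv (inv_into U \<phi> a)))"

text \<open>In a compact Lie group the tori are exactly the closed connected abelian subgroups.\<close>

definition lie_torus :: "('g, 'e::real_normed_vector, 'm) lie_data_scheme \<Rightarrow> 'g set \<Rightarrow> bool" where
  "lie_torus G K \<longleftrightarrow> subgroup K G \<and> closedin (lie_top G) K \<and> connectedin (lie_top G) K \<and>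
     (\<forall>g\<in>K. \<forall>h\<in>K. g \<otimes>\<^bsub>G\<^esub> h = h \<otimes>\<^bsub>G\<^esub> g)"

definition maximal_torus :: "('g, 'e::real_normed_vector, 'm) lie_data_scheme \<Rightarrow> 'g set \<Rightarrow> bool" where
  "maximal_torus G K \<longleftrightarrow> lie_torus G K \<and> (\<forall>K'. lie_torus G K' \<and> K \<subseteq> K' \<longrightarrow> K' = K)"

section \<open>Finite-dimensional Hilbert spaces and representations\<close>

text \<open>The Hilbert space with orthonormal basis indexed by \<open>I\<close>. Operators are functions on
  vectors, and only their values on the space on which they are considered matter.\<close>

definition cspace :: "'i set \<Rightarrow> ('i \<Rightarrow> complex) set" where
  "cspace I = {v. \<forall>i. i \<notin> I \<longrightarrow> v i = 0}"

definition cinner :: "'i set \<Rightarrow> ('i \<Rightarrow> complex) \<Rightarrow> ('i \<Rightarrow> complex) \<Rightarrow> complex" where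
  "cinner I u v = (\<Sum>i\<in>I. cnj (u i) * v i)"

definition ket :: "'i \<Rightarrow> ('i \<Rightarrow> complex)" where
  "ket i = (\<lambda>j. if j = i then 1 else 0)"

definition csubspace :: "('i \<Rightarrow> complex) set \<Rightarrow> bool" where
  "csubspace W \<longleftrightarrow> (\<lambda>_. 0) \<in> W \<and> (\<forall>u\<in>W. \<forall>v\<in>W. (\<lambda>i. u i + v i) \<in> W) \<and>
     (\<forall>c. \<forall>v\<in>W. (\<lambda>i. c * v i) \<in> W)"

definition linear_op :: "'i set \<Rightarrow> 'j set \<Rightarrow> (('i \<Rightarrow> complex) \<Rightarrow> ('j \<Rightarrow> complex)) \<Rightarrow> bool" where
  "linear_op I J A \<longleftrightarrow>
     (\<forall>v\<in>cspace I. A v \<in> cspace J) \<and>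
     (\<forall>u\<in>cspace I. \<forall>v\<in>cspace I. A (\<lambda>i. u i + v i) = (\<lambda>j. A u j + A v j)) \<and>
     (\<forall>c. \<forall>v\<in>cspace I. A (\<lambda>i. c * v i) = (\<lambda>j. c * A v j))"

definition unitary_op :: "'i set \<Rightarrow> 'j set \<Rightarrow> (('i \<Rightarrow> complex) \<Rightarrow> ('j \<Rightarrow> complex)) \<Rightarrow> bool" where
  "unitary_op I J A \<longleftrightarrow> linear_op I J A \<and> A ` cspace I = cspace J \<and>
     (\<forall>u\<in>cspace I. \<forall>v\<in>cspace I. cinner J (A u) (A v) = cinner I u v)"

definition fd_representation ::
  "('g, 'e::real_normed_vector, 'm) lie_data_scheme \<Rightarrow> 'i set \<Rightarrow>
   ('g \<Rightarrow> ('i \<Rightarrow> complex) \<Rightarrow> ('i \<Rightarrow> complex)) \<Rightarrow> bool" where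
  "fd_representation G I \<pi> \<longleftrightarrow> finite I \<and>
     (\<forall>g\<in>carrier G. linear_op I I (\<pi> g)) \<and>
     (\<forall>v\<in>cspace I. \<pi> \<one>\<^bsub>G\<^esub> v = v) \<and>
     (\<forall>g\<in>carrier G. \<forall>h\<in>carrier G. \<forall>v\<in>cspace I. \<pi> (g \<otimes>\<^bsub>G\<^esub> h) v = \<pi> g (\<pi> h v)) \<and>
     (\<forall>v\<in>cspace I. \<forall>i\<in>I. continuous_map (lie_top G) euclidean (\<lambda>g. \<pi> g v i))"

definition irreducible_rep ::
  "('g, 'e::real_normed_vector, 'm) lie_data_scheme \<Rightarrow> 'i set \<Rightarrow>
   ('g \<Rightarrow> ('i \<Rightarrow> complex) \<Rightarrow> ('i \<Rightarrow> complex)) \<Rightarrow> bool" where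
  "irreducible_rep G I \<pi> \<longleftrightarrow> fd_representation G I \<pi> \<and> I \<noteq> {} \<and>
     (\<forall>W. W \<subseteq> cspace I \<and> csubspace W \<and> (\<forall>g\<in>carrier G. \<forall>v\<in>W. \<pi> g v \<in> W) \<longrightarrow>
        W = {\<lambda>_. 0} \<or> W = cspace I)"

definition intertwiner ::
  "('g, 'm) monoid_scheme \<Rightarrow>
   'i set \<Rightarrow> ('g \<Rightarrow> ('i \<Rightarrow> complex) \<Rightarrow> ('i \<Rightarrow> complex)) \<Rightarrow>
   'j set \<Rightarrow> ('g \<Rightarrow> ('j \<Rightarrow> complex) \<Rightarrow> ('j \<Rightarrow> complex)) \<Rightarrow>
   (('i \<Rightarrow> complex) \<Rightarrow> ('j \<Rightarrow> complex)) \<Rightarrow> bool" where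
  "intertwiner G I \<pi> J \<rho> A \<longleftrightarrow> linear_op I J A \<and>
     (\<forall>g\<in>carrier G. \<forall>v\<in>cspace I. A (\<pi> g v) = \<rho> g (A v))"

definition equivalent_rep ::
  "('g, 'm) monoid_scheme \<Rightarrow>
   'i set \<Rightarrow> ('g \<Rightarrow> ('i \<Rightarrow> complex) \<Rightarrow> ('i \<Rightarrow> complex)) \<Rightarrow>
   'j set \<Rightarrow> ('g \<Rightarrow> ('j \<Rightarrow> complex) \<Rightarrow> ('j \<Rightarrow> complex)) \<Rightarrow> bool" where
  "equivalent_rep G I \<pi> J \<rho> \<longleftrightarrow>
     (\<exists>A. intertwiner G I \<pi> J \<rho> A \<and> bij_betw A (cspace I) (cspace J))"

section \<open>Tensor products\<close>

text \<open>A tensor product of spaces with bases indexed by letters has its basis indexed by words,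
  so vectors are functions on words and \<open>tensor\<close> is the product of the tensor algebra. If \<open>u\<close>
  is supported on words of length \<open>n\<close>, then only the summand \<open>i = n\<close> contributes.\<close>

definition tensor :: "('w list \<Rightarrow> complex) \<Rightarrow> ('w list \<Rightarrow> complex) \<Rightarrow> ('w list \<Rightarrow> complex)" where
  "tensor u v = (\<lambda>ws. \<Sum>i\<le>length ws. u (take i ws) * v (drop i ws))"

text \<open>The operator \<open>A \<otimes> B\<close> on the tensor product of \<open>cspace I\<close> and \<open>cspace J\<close>, given by
  \<open>(A \<otimes> B) (u \<otimes> v) = A u \<otimes> B v\<close> on basis vectors and extended linearly.\<close>

definition tensor_op ::
  "'w list set \<Rightarrow> 'w list set \<Rightarrow>
   (('w list \<Rightarrow> complex) \<Rightarrow> ('w list \<Rightarrow> complex)) \<Rightarrow>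
   (('w list \<Rightarrow> complex) \<Rightarrow> ('w list \<Rightarrow> complex)) \<Rightarrow>
   (('w list \<Rightarrow> complex) \<Rightarrow> ('w list \<Rightarrow> complex))" where
  "tensor_op I J A B v =
     (\<lambda>ws. \<Sum>xs\<in>I. \<Sum>ys\<in>J. v (xs @ ys) * tensor (A (ket xs)) (B (ket ys)) ws)"

text \<open>Permutation of tensor factors, sending \<open>ket ws\<close> to \<open>ket (permute_list \<sigma> ws)\<close>: the
  \<open>i\<close>-th factor of the target is the \<open>\<sigma> i\<close>-th factor of the source.\<close>

definition permute_factors :: "(nat \<Rightarrow> nat) \<Rightarrow> ('w list \<Rightarrow> complex) \<Rightarrow> ('w list \<Rightarrow> complex)" where
  "permute_factors \<sigma> v = (\<lambda>ws. v (permute_list (inv_into UNIV \<sigma>) ws))"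

section \<open>The fixed irreducible representations and their couplings\<close>

text \<open>
  \<^item> \<open>irreps G\<close>: the labels of the isomorphism classes of irreducible representations;
  \<^item> \<open>weight_torus G\<close>: the maximal torus to which weights refer;
  \<^item> \<open>weights G l\<close>: the labels of the weight basis of the representation \<open>l\<close>;
  \<^item> \<open>irrep G l\<close>: the representation \<open>D\<^sup>l\<close>, acting on functions on one-letter words;
  \<^item> \<open>coupling_iso G l1 l2\<close>: the unitary isomorphism from the direct sum onto the tensor product.
\<close>

record ('g, 'e, 'l, 'w) recoupling_data = "('g, 'e) lie_data" +
  weight_torus :: "'g set"
  irreps :: "'l set"
  weights :: "'l \<Rightarrow> 'w set"
  irrep :: "'l \<Rightarrow> 'g \<Rightarrow> ('w list \<Rightarrow> complex) \<Rightarrow> ('w list \<Rightarrow> complex)"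
  coupling_iso :: "'l \<Rightarrow> 'l \<Rightarrow> (('l \<times> nat) \<times> 'w list \<Rightarrow> complex) \<Rightarrow> ('w list \<Rightarrow> complex)"

text \<open>\<open>cspace (basis_words G ls)\<close> is the tensor product of the spaces \<open>H\<^sub>l\<close>, \<open>l\<close> from \<open>ls\<close>;
  in particular \<open>H\<^sub>l\<close> itself is \<open>cspace (basis_words G [l])\<close>.\<close>

definition basis_words ::
  "('g, 'e::real_normed_vector, 'l, 'w, 'm) recoupling_data_scheme \<Rightarrow> 'l list \<Rightarrow> 'w list set" where
  "basis_words G ls = listset (map (weights G) ls)"

definition pair_rep ::
  "('g, 'e::real_normed_vector, 'l, 'w, 'm) recoupling_data_scheme \<Rightarrow> 'l \<Rightarrow> 'l \<Rightarrow>
   'g \<Rightarrow> ('w list \<Rightarrow> complex) \<Rightarrow> ('w list \<Rightarrow> complex)" where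
  "pair_rep G l1 l2 g =
     tensor_op (basis_words G [l1]) (basis_words G [l2]) (irrep G l1 g) (irrep G l2 g)"

definition decomposition ::
  "('g, 'e::real_normed_vector, 'l, 'w, 'm) recoupling_data_scheme \<Rightarrow>
   'i set \<Rightarrow> ('g \<Rightarrow> ('i \<Rightarrow> complex) \<Rightarrow> ('i \<Rightarrow> complex)) \<Rightarrow>
   'l list \<Rightarrow> (nat \<Rightarrow> ('w list \<Rightarrow> complex) \<Rightarrow> ('i \<Rightarrow> complex)) \<Rightarrow> bool" where
  "decomposition G I \<pi> ls A \<longleftrightarrow>
     (\<forall>j<length ls. ls ! j \<in> irreps G \<and>
        intertwiner G (basis_words G [ls ! j]) (irrep G (ls ! j)) I \<pi> (A j)) \<and>
     (\<forall>v\<in>cspace I. \<exists>!u. u \<in> (\<Pi>\<^sub>E j\<in>{..<length ls}. cspace (basis_words G [ls ! j])) \<and>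
        v = (\<lambda>i. \<Sum>j<length ls. A j (u j) i))"

text \<open>The multiplicity of \<open>l\<close> in the tensor product of \<open>l1\<close> and \<open>l2\<close>, as the number of
  occurrences in any decomposition into irreducible representations.\<close>

definition tensor_multiplicity ::
  "('g, 'e::real_normed_vector, 'l, 'w, 'm) recoupling_data_scheme \<Rightarrow> 'l \<Rightarrow> 'l \<Rightarrow> 'l \<Rightarrow> nat" where
  "tensor_multiplicity G l1 l2 l =
     (THE n. \<exists>ls A. decomposition G (basis_words G [l1, l2]) (pair_rep G l1 l2) ls A \<and>
        n = count_list ls l)"

definition couplings ::
  "('g, 'e::real_normed_vector, 'l, 'w, 'm) recoupling_data_scheme \<Rightarrow> 'l \<Rightarrow> 'l \<Rightarrow> ('l \<times> nat) set" where
  "couplings G l1 l2 =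
     {(l, k). l \<in> irreps G \<and> tensor_multiplicity G l1 l2 l > 0 \<and>
        1 \<le> k \<and> k \<le> tensor_multiplicity G l1 l2 l}"

text \<open>The direct sum of the spaces \<open>H\<^sub>l\<close> over all \<open>(l, k)\<close> in \<open>couplings G l1 l2\<close> has its basis
  indexed by pairs of a summand and a basis element of that summand.\<close>

definition sum_basis ::
  "('g, 'e::real_normed_vector, 'l, 'w, 'm) recoupling_data_scheme \<Rightarrow> 'l \<Rightarrow> 'l \<Rightarrow>
   (('l \<times> nat) \<times> 'w list) set" where
  "sum_basis G l1 l2 = (SIGMA c:couplings G l1 l2. basis_words G [fst c])"

definition sum_rep ::
  "('g, 'e::real_normed_vector, 'l, 'w, 'm) recoupling_data_scheme \<Rightarrow> 'l \<Rightarrow> 'l \<Rightarrow>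
   'g \<Rightarrow> (('l \<times> nat) \<times> 'w list \<Rightarrow> complex) \<Rightarrow> (('l \<times> nat) \<times> 'w list \<Rightarrow> complex)" where
  "sum_rep G l1 l2 g v = (\<lambda>(c, ws).
     if c \<in> couplings G l1 l2 then irrep G (fst c) g (\<lambda>vs. v (c, vs)) ws else 0)"

definition summand_incl :: "'c \<Rightarrow> ('i \<Rightarrow> complex) \<Rightarrow> ('c \<times> 'i \<Rightarrow> complex)" where
  "summand_incl c v = (\<lambda>(c', i). if c' = c then v i else 0)"

definition coupling_inj ::
  "('g, 'e::real_normed_vector, 'l, 'w, 'm) recoupling_data_scheme \<Rightarrow> 'l \<Rightarrow> 'l \<Rightarrow> 'l \<times> nat \<Rightarrow>
   ('w list \<Rightarrow> complex) \<Rightarrow> ('w list \<Rightarrow> complex)" where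
  "coupling_inj G l1 l2 c v = coupling_iso G l1 l2 (summand_incl c v)"

locale recoupling_setting = compact_lie_group G
  for G :: "('g, 'e::real_normed_vector, 'l, 'w, 'm) recoupling_data_scheme" (structure) +
  assumes weight_torus: "maximal_torus G (weight_torus G)"
    and irrep_irreducible:
      "l \<in> irreps G \<Longrightarrow> irreducible_rep G (basis_words G [l]) (irrep G l)"
    and irrep_unitary:
      "\<lbrakk>l \<in> irreps G; g \<in> carrier G\<rbrakk> \<Longrightarrow>
       unitary_op (basis_words G [l]) (basis_words G [l]) (irrep G l g)"
    and irrep_inequivalent:
      "\<lbrakk>l \<in> irreps G; l' \<in> irreps G;
        equivalent_rep G (basis_words G [l]) (irrep G l) (basis_words G [l']) (irrep G l')\<rbrakk> \<Longrightarrow>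
       l = l'"
    and irrep_complete:
      "irreducible_rep G {..<n} \<pi> \<Longrightarrow>
       \<exists>l\<in>irreps G. equivalent_rep G {..<n::nat} \<pi> (basis_words G [l]) (irrep G l)"
    and weight_basis:
      "\<lbrakk>l \<in> irreps G; \<mu> \<in> weights G l; t \<in> weight_torus G\<rbrakk> \<Longrightarrow>
       \<exists>c. irrep G l t (ket [\<mu>]) = (\<lambda>ws. c * ket [\<mu>] ws)"
    and coupling_iso_unitary:
      "\<lbrakk>l1 \<in> irreps G; l2 \<in> irreps G\<rbrakk> \<Longrightarrow>
       unitary_op (sum_basis G l1 l2) (basis_words G [l1, l2]) (coupling_iso G l1 l2)"
    and coupling_iso_equivariant:
      "\<lbrakk>l1 \<in> irreps G; l2 \<in> irreps G\<rbrakk> \<Longrightarrow>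
       intertwiner G (sum_basis G l1 l2) (sum_rep G l1 l2)
         (basis_words G [l1, l2]) (pair_rep G l1 l2) (coupling_iso G l1 l2)"

section \<open>Coupling trees\<close>

datatype btree = Leaf | Node btree btree

text \<open>A vertex is the path leading to it from the root \<open>[]\<close>, with \<open>False\<close> for the left and
  \<open>True\<close> for the right child.\<close>

type_synonym vertex = "bool list"

abbreviation lchild :: "vertex \<Rightarrow> vertex" where "lchild x \<equiv> x @ [False]"
abbreviation rchild :: "vertex \<Rightarrow> vertex" where "rchild x \<equiv> x @ [True]"

primrec leaf_list :: "btree \<Rightarrow> vertex list" where
  "leaf_list Leaf = [[]]"
| "leaf_list (Node l r) = map (Cons False) (leaf_list l) @ map (Cons True) (leaf_list r)"

primrec nodes :: "btree \<Rightarrow> vertex set" where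
  "nodes Leaf = {}"
| "nodes (Node l r) = insert [] (Cons False ` nodes l \<union> Cons True ` nodes r)"

definition leaves :: "btree \<Rightarrow> vertex set" where
  "leaves T = set (leaf_list T)"

definition internal_nodes :: "btree \<Rightarrow> vertex set" where
  "internal_nodes T = nodes T - {[]}"

definition coupling_tree :: "btree \<Rightarrow> bool" where
  "coupling_tree T \<longleftrightarrow> card (leaves T) \<ge> 2"

text \<open>A label is a highest weight together with a multiplicity counter; the counter is
  meaningless at leaves and never used there.\<close>

type_synonym 'l labelling = "vertex \<Rightarrow> 'l \<times> nat"

abbreviation hw :: "'l labelling \<Rightarrow> vertex \<Rightarrow> 'l" where "hw \<alpha> x \<equiv> fst (\<alpha> x)"
abbreviation mc :: "'l labelling \<Rightarrow> vertex \<Rightarrow> nat" where "mc \<alpha> x \<equiv> snd (\<alpha> x)"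

definition is_labelling ::
  "('g, 'e::real_normed_vector, 'l, 'w, 'm) recoupling_data_scheme \<Rightarrow> btree \<Rightarrow> 'l labelling \<Rightarrow> bool" where
  "is_labelling G T \<alpha> \<longleftrightarrow> (\<forall>y\<in>leaves T. hw \<alpha> y \<in> irreps G) \<and>
     (\<forall>x\<in>nodes T. (hw \<alpha> x, mc \<alpha> x) \<in> couplings G (hw \<alpha> (lchild x)) (hw \<alpha> (rchild x)))"

definition leaf_weights :: "btree \<Rightarrow> 'l labelling \<Rightarrow> 'l list" where
  "leaf_weights T \<alpha> = map (hw \<alpha>) (leaf_list T)"

primrec tree_inj ::
  "('g, 'e::real_normed_vector, 'l, 'w, 'm) recoupling_data_scheme \<Rightarrow> btree \<Rightarrow> 'l labelling \<Rightarrow>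
   ('w list \<Rightarrow> complex) \<Rightarrow> ('w list \<Rightarrow> complex)" where
  "tree_inj G Leaf \<alpha> = id"
| "tree_inj G (Node l r) \<alpha> =
     tensor_op (basis_words G [hw \<alpha> [False]]) (basis_words G [hw \<alpha> [True]])
       (tree_inj G l (\<lambda>p. \<alpha> (False # p))) (tree_inj G r (\<lambda>p. \<alpha> (True # p)))
     \<circ> coupling_inj G (hw \<alpha> [False]) (hw \<alpha> [True]) (\<alpha> [])"

definition tree_ket ::
  "('g, 'e::real_normed_vector, 'l, 'w, 'm) recoupling_data_scheme \<Rightarrow> btree \<Rightarrow> 'l labelling \<Rightarrow>
   'w \<Rightarrow> ('w list \<Rightarrow> complex)" where
  "tree_ket G T \<alpha> \<mu> = tree_inj G T \<alpha> (ket [\<mu>])"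

section \<open>Recoupling coefficients\<close>

text \<open>The coefficient \<open>R(T2|T1)\<close>, for labellings with the same highest weight at the root and with
  \<open>leaf_weights T2 \<alpha>2 = permute_list \<sigma> (leaf_weights T1 \<alpha>1)\<close>, is the common value for all \<open>\<mu>\<close>.\<close>

definition recoupling ::
  "('g, 'e::real_normed_vector, 'l, 'w, 'm) recoupling_data_scheme \<Rightarrow> (nat \<Rightarrow> nat) \<Rightarrow>
   btree \<Rightarrow> 'l labelling \<Rightarrow> btree \<Rightarrow> 'l labelling \<Rightarrow> complex" where
  "recoupling G \<sigma> T2 \<alpha>2 T1 \<alpha>1 =
     (THE c. \<forall>\<mu>\<in>weights G (hw \<alpha>1 []).
        cinner (basis_words G (leaf_weights T2 \<alpha>2))
          (tree_ket G T2 \<alpha>2 \<mu>) (permute_factors \<sigma> (tree_ket G T1 \<alpha>1 \<mu>)) = c)"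

definition join_label :: "'l labelling \<Rightarrow> 'l labelling \<Rightarrow> 'l \<times> nat \<Rightarrow> 'l labelling" where
  "join_label \<alpha>1 \<alpha>2 c p = (case p of [] \<Rightarrow> c | b # q \<Rightarrow> if b then \<alpha>2 q else \<alpha>1 q)"

primrec leaf_dup :: "btree \<Rightarrow> btree" where
  "leaf_dup Leaf = Node Leaf Leaf"
| "leaf_dup (Node l r) = Node (leaf_dup l) (leaf_dup r)"

definition dup_label ::
  "btree \<Rightarrow> 'l labelling \<Rightarrow> 'l labelling \<Rightarrow> 'l labelling \<Rightarrow> (vertex \<Rightarrow> nat) \<Rightarrow> 'l labelling" where
  "dup_label T \<alpha>1 \<alpha>2 \<alpha>3 ks p =
     (if p \<in> nodes T then \<alpha>3 p
      else if p \<in> leaves T then (hw \<alpha>3 p, ks p)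
      else if last p then \<alpha>2 (butlast p) else \<alpha>1 (butlast p))"

text \<open>The leaf weights of the leaf duplication are \<open>[a\<^sub>1, b\<^sub>1, \<dots>, a\<^sub>N, b\<^sub>N]\<close>, those of the join are
  \<open>[a\<^sub>1, \<dots>, a\<^sub>N, b\<^sub>1, \<dots>, b\<^sub>N]\<close>.\<close>

definition unshuffle :: "nat \<Rightarrow> nat \<Rightarrow> nat" where
  "unshuffle N i = (if i < N then 2 * i else if i < 2 * N then 2 * (i - N) + 1 else i)"

definition admissible_triple ::
  "('g, 'e::real_normed_vector, 'l, 'w, 'm) recoupling_data_scheme \<Rightarrow> btree \<Rightarrow>
   'l labelling \<Rightarrow> 'l labelling \<Rightarrow> 'l labelling \<Rightarrow> (vertex \<Rightarrow> nat) \<Rightarrow> nat \<Rightarrow> bool" where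
  "admissible_triple G T \<alpha>1 \<alpha>2 \<alpha>3 ks k \<longleftrightarrow>
     (\<forall>y\<in>leaves T. (hw \<alpha>3 y, ks y) \<in> couplings G (hw \<alpha>1 y) (hw \<alpha>2 y)) \<and>
     (hw \<alpha>3 [], k) \<in> couplings G (hw \<alpha>1 []) (hw \<alpha>2 [])"

definition tree_recoupling ::
  "('g, 'e::real_normed_vector, 'l, 'w, 'm) recoupling_data_scheme \<Rightarrow> btree \<Rightarrow>
   'l labelling \<Rightarrow> 'l labelling \<Rightarrow> nat \<Rightarrow> 'l labelling \<Rightarrow> (vertex \<Rightarrow> nat) \<Rightarrow> complex" where
  "tree_recoupling G T \<alpha>1 \<alpha>2 k \<alpha>3 ks =
     (if admissible_triple G T \<alpha>1 \<alpha>2 \<alpha>3 ks k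
      then recoupling G (unshuffle (card (leaves T)))
             (Node T T) (join_label \<alpha>1 \<alpha>2 (hw \<alpha>3 [], k))
             (leaf_dup T) (dup_label T \<alpha>1 \<alpha>2 \<alpha>3 ks)
      else 0)"

abbreviation cherry :: btree where "cherry \<equiv> Node Leaf Leaf"

definition cherry_label :: "'l \<Rightarrow> 'l \<Rightarrow> 'l \<Rightarrow> nat \<Rightarrow> 'l labelling" where
  "cherry_label l' l'' l k p = (if p = [] then (l, k) else if p = [False] then (l', 0) else (l'', 0))"

text \<open>The four arguments after \<open>G\<close> are the rows of the symbol.\<close>

fun nine_lambda ::
  "('g, 'e::real_normed_vector, 'l, 'w, 'm) recoupling_data_scheme \<Rightarrow>
   'l \<times> 'l \<times> 'l \<times> nat \<Rightarrow> 'l \<times> 'l \<times> 'l \<times> nat \<Rightarrow> 'l \<times> 'l \<times> 'l \<times> nat \<Rightarrow> nat \<times> nat \<times> nat \<Rightarrow> complex" where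
  "nine_lambda G (a1, b1, c1, k1) (a2, b2, c2, k2) (a3, b3, c3, k3) (k', k'', k) =
     (if (c1, k1) \<in> couplings G a1 b1 \<and> (c2, k2) \<in> couplings G a2 b2 \<and> (c3, k3) \<in> couplings G a3 b3
      then tree_recoupling G cherry (cherry_label a1 b1 c1 k1) (cherry_label a2 b2 c2 k2) k
             (cherry_label a3 b3 c3 k3) (\<lambda>y. if y = [False] then k' else k'')
      else 0)"

text \<open>Assembles the counters \<open>k\<^sup>x\<close>: prescribed at the root and the leaves, running at the internal
  nodes.\<close>

definition counter :: "btree \<Rightarrow> nat \<Rightarrow> (vertex \<Rightarrow> nat) \<Rightarrow> (vertex \<Rightarrow> nat) \<Rightarrow> vertex \<Rightarrow> nat" where
  "counter T k ks \<kappa> x = (if x = [] then k else if x \<in> leaves T then ks x else \<kappa> x)"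

end

theory Submission
  imports Defs "Jordan_Normal_Form.Char_Poly"
begin

text \<open>Contract the vector of the duplicated tree with the vectors of the two factors of the join,
  leaving out the coupling at the new root. This gives an operator from the third root space to the
  tensor product of the first two, and its components along the fixed couplings are the recoupling
  coefficients. If the root has subtrees, the operator is computed from those of the subtrees;
  expanding these in couplings leaves the operators that belong to a cherry, which are combinations
  of couplings by Schur's lemma, with the \<open>9\<lambda>\<close> symbols as coefficients. Induction on the
  tree gives the sum over the counters of the internal nodes.\<close>

section \<open>Schur's lemma\<close>

text \<open>A recoupling coefficient is one scalar, whereas the coupling at a parent node contracts
  all basis vectors of the root spaces of its two subtrees. The scalars of the subtrees do not
  compose, so the induction has to carry operators. This also explains the sum: expanding the
  operator of a subtree gives one term for every copy of the third weight at its root, and the index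
  of the copy is the counter of an internal node. A leaf contributes a single coupling, the one with
  the prescribed counter. At the root of \<open>T\<close> the expansion stays open until the end,
  where orthonormality of the couplings selects \<open>k\<close>. Operators in the setting are
  functions that are meaningful only on their \<open>cspace\<close>. They are replaced by matrices
  over basis words, with pairs of words for tensor products, so that composition, tensor product and
  adjoint become finite sums. Adjoints occur because the join stands on the conjugated side of the
  inner product; they remain equivariant because the representations are unitary. Data that is not
  admissible is treated apart from the induction: both sides are then 0.\<close>

lemma finite_matrix_eigenvector:
  fixes M :: "'i \<Rightarrow> 'i \<Rightarrow> complex"
  assumes "finite I" and "I \<noteq> {}"
  shows "\<exists>c v. v \<in> cspace I \<and> v \<noteq> (\<lambda>_. 0) \<and> (\<forall>i\<in>I. (\<Sum>j\<in>I. M i j * v j) = c * v i)"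
proof -
  define n where "n = card I"
  obtain h where h: "bij_betw h {0..<n} I"
    using ex_bij_betw_nat_finite[OF assms(1)] n_def by blast
  \<comment> \<open>Matrices of type \<open>mat\<close> are indexed by \<open>{0..<n}\<close>, so
    \<open>M\<close> is carried over along the enumeration \<open>h\<close> of \<open>I\<close>, and
    the eigenvector comes back along \<open>h'\<close>.\<close>
  define A where "A = mat n n (\<lambda>(a, b). M (h a) (h b))"
  have A: "A \<in> carrier_mat n n" unfolding A_def by simp
  \<comment> \<open>Since \<open>I\<close> is nonempty, the characteristic polynomial is not
    constant; its root is where algebraic closedness of the complex numbers enters Schur's
    lemma.\<close>
  have "n > 0" using assms n_def by (simp add: card_gt_0_iff)
  then have "degree (char_poly A) > 0" using degree_monic_char_poly[OF A] by auto
  then have "\<not> constant (poly (char_poly A))" by (simp add: constant_degree)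
  then obtain c where "poly (char_poly A) c = 0"
    using fundamental_theorem_of_algebra by blast
  then obtain w where w: "w \<in> carrier_vec n" "w \<noteq> 0\<^sub>v n" "A *\<^sub>v w = c \<cdot>\<^sub>v w"
    using A eigenvalue_root_char_poly[OF A] unfolding eigenvalue_def eigenvector_def by auto
  define h' where "h' = inv_into {0..<n} h"
  have h'h: "h' (h a) = a" if "a < n" for a
    using that h by (simp add: h'_def bij_betw_inv_into_left)
  have hh': "h (h' i) = i" "h' i < n" if "i \<in> I" for i
    using that h bij_betw_inv_into[OF h]
    by (auto simp: h'_def bij_betw_inv_into_right dest: bij_betwE)
  define v where "v = (\<lambda>i. if i \<in> I then w $ h' i else 0)"
  have hI: "h a \<in> I" if "a < n" for a using that h by (auto dest: bij_betwE)
  have "v \<in> cspace I" by (simp add: v_def cspace_def)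
  moreover have "v \<noteq> (\<lambda>_. 0)"
  proof
    assume v0: "v = (\<lambda>_. 0)"
    have "w $ a = 0" if "a < n" for a
      using fun_cong[OF v0, of "h a"] that hI h'h by (simp add: v_def)
    then have "w = 0\<^sub>v n" using w(1) by (intro eq_vecI) auto
    then show False using w(2) by simp
  qed
  moreover have "(\<Sum>j\<in>I. M i j * v j) = c * v i" if i: "i \<in> I" for i
  proof -
    have "(\<Sum>j\<in>I. M i j * v j) = (\<Sum>b\<in>{0..<n}. M i (h b) * v (h b))"
      using sum.reindex_bij_betw[OF h, of "\<lambda>j. M i j * v j"] by simp
    also have "\<dots> = (\<Sum>b\<in>{0..<n}. A $$ (h' i, b) * w $ b)"
      by (rule sum.cong) (use hh'[OF i] hI h'h in \<open>auto simp: A_def v_def\<close>)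
    also have "\<dots> = (A *\<^sub>v w) $ h' i"
      using hh'[OF i] A w(1) by (simp add: scalar_prod_def)
    also have "\<dots> = c * v i"
      using hh'[OF i] w(1) i by (simp add: w(3) v_def)
    finally show ?thesis .
  qed
  ultimately show ?thesis by blast
qed

section \<open>Linear and unitary operators in coordinates\<close>

lemma zero_in_cspace [simp]: "(\<lambda>_. 0) \<in> cspace I"
  by (simp add: cspace_def)

lemma ket_in_cspace [simp]: "i \<in> I \<Longrightarrow> ket i \<in> cspace I"
  by (auto simp: cspace_def ket_def)

lemma linear_op_cspace: "linear_op I J A \<Longrightarrow> v \<in> cspace I \<Longrightarrow> A v \<in> cspace J"
  by (simp add: linear_op_def)

lemma linear_op_zero: "linear_op I J A \<Longrightarrow> A (\<lambda>_. 0) = (\<lambda>_. 0)"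
proof -
  assume A: "linear_op I J A"
  have "\<forall>c. \<forall>v\<in>cspace I. A (\<lambda>i. c * v i) = (\<lambda>j. c * A v j)"
    using A by (simp add: linear_op_def)
  from this[rule_format, of "\<lambda>_. 0" 0] show ?thesis by simp
qed

lemma linear_op_add:
  "linear_op I J A \<Longrightarrow> u \<in> cspace I \<Longrightarrow> v \<in> cspace I \<Longrightarrow> A (\<lambda>i. u i + v i) = (\<lambda>j. A u j + A v j)"
  by (simp add: linear_op_def)

lemma linear_op_scale:
  "linear_op I J A \<Longrightarrow> v \<in> cspace I \<Longrightarrow> A (\<lambda>i. c * v i) = (\<lambda>j. c * A v j)"
  by (simp add: linear_op_def)

lemma linear_op_expand:
  assumes A: "linear_op I J A" and "finite I" and v: "v \<in> cspace I"
  shows "A v = (\<lambda>j. \<Sum>i\<in>I. v i * A (ket i) j)"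
proof -
  \<comment> \<open>Truncations of \<open>v\<close> to subsets of \<open>I\<close> stay in
    \<open>cspace I\<close>, the domain on which \<open>linear_op\<close> speaks, so the coordinates
    can be added one at a time.\<close>
  have "A (\<lambda>i. if i \<in> S then v i else 0) = (\<lambda>j. \<Sum>i\<in>S. v i * A (ket i) j)"
    if "finite S" "S \<subseteq> I" for S
    using that
  proof (induction S rule: finite_induct)
    case empty
    then show ?case by (simp add: linear_op_zero[OF A])
  next
    case (insert s S)
    have eq: "(\<lambda>i. if i \<in> insert s S then v i else 0) =
        (\<lambda>i. v s * ket s i + (if i \<in> S then v i else 0))"
      using insert.hyps by (auto simp: ket_def)
    have *: "(\<lambda>i. v s * ket s i) \<in> cspace I" "(\<lambda>i. if i \<in> S then v i else 0) \<in> cspace I"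
      using insert.prems by (auto simp: cspace_def ket_def)
    have "A (\<lambda>i. if i \<in> insert s S then v i else 0) =
        (\<lambda>j. v s * A (ket s) j + (\<Sum>i\<in>S. v i * A (ket i) j))"
      unfolding eq linear_op_add[OF A *] using insert linear_op_scale[OF A, of "ket s" "v s"] by simp
    then show ?case using insert.hyps by simp
  qed
  from this[of I] have "A (\<lambda>i. if i \<in> I then v i else 0) = (\<lambda>j. \<Sum>i\<in>I. v i * A (ket i) j)"
    using \<open>finite I\<close> by simp
  moreover have "(\<lambda>i. if i \<in> I then v i else 0) = v" using v by (auto simp: cspace_def)
  ultimately show ?thesis by simp
qed

lemma cinner_ket: "finite I \<Longrightarrow> i \<in> I \<Longrightarrow> cinner I (ket i) v = v i"
  by (simp add: cinner_def ket_def if_distrib[of cnj] if_distrib[of "\<lambda>x. x * _"] cong: if_cong)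

lemma unitary_op_columns:
  assumes A: "unitary_op I J A" and "finite I" and "i \<in> I" "i' \<in> I"
  shows "(\<Sum>j\<in>J. cnj (A (ket i) j) * A (ket i') j) = (if i = i' then 1 else 0)"
proof -
  have "cinner J (A (ket i)) (A (ket i')) = cinner I (ket i) (ket i')"
    using A assms(3,4) by (simp add: unitary_op_def)
  then show ?thesis using assms(2-4) by (simp add: cinner_ket flip: cinner_def) (simp add: ket_def)
qed

text \<open>Surjectivity gives \<open>h = A u\<close>, and preservation of the inner product
  identifies the coordinate \<open>u i\<close> with the product of \<open>A (ket i)\<close> and
  \<open>h\<close>: the Parseval expansion in the image basis.\<close>

lemma unitary_op_complete:
  assumes A: "unitary_op I J A" and "finite I" and h: "h \<in> cspace J"
  shows "h j = (\<Sum>i\<in>I. (\<Sum>j'\<in>J. cnj (A (ket i) j') * h j') * A (ket i) j)"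
proof -
  obtain u where u: "u \<in> cspace I" "h = A u"
    using A h unfolding unitary_op_def by (metis imageE)
  have "(\<Sum>j'\<in>J. cnj (A (ket i) j') * h j') = u i" if "i \<in> I" for i
  proof -
    have "cinner J (A (ket i)) (A u) = cinner I (ket i) u"
      using A u(1) that by (simp add: unitary_op_def)
    then show ?thesis using that \<open>finite I\<close> u(2) by (simp add: cinner_ket flip: cinner_def)
  qed
  then have "(\<Sum>i\<in>I. (\<Sum>j'\<in>J. cnj (A (ket i) j') * h j') * A (ket i) j) = (\<Sum>i\<in>I. u i * A (ket i) j)"
    by simp
  also have "\<dots> = h j"
    using linear_op_expand[of I J A u] A u \<open>finite I\<close> by (simp add: unitary_op_def)
  finally show ?thesis by simp
qed

text \<open>Completeness applied to a basis vector of the target yields the other half of unitarity,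
  needed later to take adjoints.\<close>

lemma unitary_op_rows:
  assumes A: "unitary_op I J A" and "finite I" "finite J" and j: "j \<in> J" "j' \<in> J"
  shows "(\<Sum>i\<in>I. A (ket i) j * cnj (A (ket i) j')) = (if j = j' then 1 else 0)"
proof -
  have "(\<Sum>k\<in>J. cnj (A (ket i) k) * ket j' k) = cnj (A (ket i) j')" for i
    using j \<open>finite J\<close> by (simp add: ket_def if_distrib[of "\<lambda>x. _ * x"] cong: if_cong)
  then show ?thesis
    using unitary_op_complete[OF A \<open>finite I\<close> ket_in_cspace[OF j(2)], of j]
    by (simp add: mult.commute ket_def)
qed

section \<open>Invariant subspaces and the two halves of Schur's lemma\<close>

lemma irreducible_subspace:
  assumes "irreducible_rep G I \<pi>" and "W \<subseteq> cspace I" and "csubspace W"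
    and "\<And>g v. g \<in> carrier G \<Longrightarrow> v \<in> W \<Longrightarrow> \<pi> g v \<in> W"
  shows "W = {\<lambda>_. 0} \<or> W = cspace I"
  using assms unfolding irreducible_rep_def by simp

text \<open>An eigenspace of an intertwiner is an invariant subspace, so by irreducibility one
  nonzero eigenvector makes it the whole space.\<close>

lemma intertwiner_kernel:
  assumes "irreducible_rep G I \<pi>" and A: "intertwiner G I \<pi> I \<pi> A"
    and "v \<in> cspace I" "v \<noteq> (\<lambda>_. 0)" "A v = (\<lambda>i. c * v i)"
  shows "\<forall>v\<in>cspace I. A v = (\<lambda>i. c * v i)"
proof -
  let ?W = "{v \<in> cspace I. A v = (\<lambda>i. c * v i)}"
  have lin: "linear_op I I A" using A by (simp add: intertwiner_def)
  have pi: "linear_op I I (\<pi> g)" if "g \<in> carrier G" for g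
    using assms(1) that by (simp add: irreducible_rep_def fd_representation_def)
  have "csubspace ?W"
    unfolding csubspace_def
  proof (intro conjI allI ballI)
    show "(\<lambda>_. 0) \<in> ?W" using linear_op_zero[OF lin] by simp
    show "(\<lambda>i. u i + v i) \<in> ?W" if "u \<in> ?W" "v \<in> ?W" for u v
      using that linear_op_add[OF lin, of u v] by (simp add: cspace_def distrib_left)
    show "(\<lambda>i. d * v i) \<in> ?W" if "v \<in> ?W" for d v
      using that linear_op_scale[OF lin, of v d] by (simp add: cspace_def mult.left_commute)
  qed
  moreover have "\<pi> g u \<in> ?W" if "g \<in> carrier G" "u \<in> ?W" for g u
    using that A linear_op_cspace[OF pi, of g u] linear_op_scale[OF pi, of g u c]
    by (simp add: intertwiner_def)
  ultimately have "?W = {\<lambda>_. 0} \<or> ?W = cspace I"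
    by (intro irreducible_subspace[OF assms(1)]) blast+
  then show ?thesis using assms(3-5) by blast
qed

lemma schur_scalar:
  assumes irr: "irreducible_rep G I \<pi>" and A: "intertwiner G I \<pi> I \<pi> A"
  shows "\<exists>c. \<forall>v\<in>cspace I. A v = (\<lambda>i. c * v i)"
proof -
  have fin: "finite I" "I \<noteq> {}"
    using irr by (auto simp: irreducible_rep_def fd_representation_def)
  have lin: "linear_op I I A" using A by (simp add: intertwiner_def)
  obtain c v where v: "v \<in> cspace I" "v \<noteq> (\<lambda>_. 0)"
    and eig: "\<forall>i\<in>I. (\<Sum>j\<in>I. A (ket j) i * v j) = c * v i"
    using finite_matrix_eigenvector[OF fin, of "\<lambda>i j. A (ket j) i"] by blast
  have "A v i = c * v i" for i
  proof (cases "i \<in> I")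
    case True
    then show ?thesis using eig linear_op_expand[OF lin fin(1) v(1)] by (simp add: mult.commute)
  next
    case False
    then show ?thesis using v(1) linear_op_cspace[OF lin v(1)] by (simp add: cspace_def)
  qed
  then show ?thesis using intertwiner_kernel[OF irr A v, of c] by blast
qed

text \<open>Kernel and image are invariant subspaces of irreducible representations, so each is zero
  or everything.\<close>

lemma schur_zero_or_bij:
  assumes I: "irreducible_rep G I \<pi>" and J: "irreducible_rep G J \<rho>"
    and A: "intertwiner G I \<pi> J \<rho> A"
  shows "(\<forall>v\<in>cspace I. A v = (\<lambda>_. 0)) \<or> bij_betw A (cspace I) (cspace J)"
proof -
  let ?K = "{v \<in> cspace I. A v = (\<lambda>_. 0)}" and ?R = "A ` cspace I"
  have lin: "linear_op I J A" using A by (simp add: intertwiner_def)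
  have pi: "linear_op I I (\<pi> g)" "linear_op J J (\<rho> g)" if "g \<in> carrier G" for g
    using I J that by (simp_all add: irreducible_rep_def fd_representation_def)
  have add: "(\<lambda>i. u i + v i) \<in> cspace I" if "u \<in> cspace I" "v \<in> cspace I" for u v
    using that by (simp add: cspace_def)
  have scale: "(\<lambda>i. c * v i) \<in> cspace I" if "v \<in> cspace I" for v c
    using that by (simp add: cspace_def)
  have "csubspace ?K"
    unfolding csubspace_def
  proof (intro conjI allI ballI)
    show "(\<lambda>_. 0) \<in> ?K" using linear_op_zero[OF lin] by simp
    show "(\<lambda>i. u i + v i) \<in> ?K" if "u \<in> ?K" "v \<in> ?K" for u v
      using that linear_op_add[OF lin, of u v] by (simp add: add)
    show "(\<lambda>i. d * v i) \<in> ?K" if "v \<in> ?K" for d v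
      using that linear_op_scale[OF lin, of v d] by (simp add: scale)
  qed
  moreover have "\<pi> g u \<in> ?K" if "g \<in> carrier G" "u \<in> ?K" for g u
    using that A linear_op_cspace[OF pi(1), of g u] linear_op_zero[OF pi(2), of g]
    by (simp add: intertwiner_def)
  ultimately have K: "?K = {\<lambda>_. 0} \<or> ?K = cspace I"
    by (intro irreducible_subspace[OF I]) blast+
  have "csubspace ?R"
    unfolding csubspace_def
  proof (intro conjI allI ballI)
    show "(\<lambda>_. 0) \<in> ?R" using imageI[of "\<lambda>_. 0" "cspace I" A] linear_op_zero[OF lin] by simp
    show "(\<lambda>i. u i + v i) \<in> ?R" if uv: "u \<in> ?R" "v \<in> ?R" for u v
    proof -
      from uv obtain a b where ab: "a \<in> cspace I" "b \<in> cspace I" "u = A a" "v = A b" by blast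
      show ?thesis
        unfolding ab(3,4) linear_op_add[OF lin ab(1,2), symmetric] by (rule imageI[OF add[OF ab(1,2)]])
    qed
    show "(\<lambda>i. c * v i) \<in> ?R" if v: "v \<in> ?R" for c v
    proof -
      from v obtain a where a: "a \<in> cspace I" "v = A a" by blast
      show ?thesis
        unfolding a(2) linear_op_scale[OF lin a(1), symmetric] by (rule imageI[OF scale[OF a(1)]])
    qed
  qed
  moreover have "?R \<subseteq> cspace J" using linear_op_cspace[OF lin] by auto
  moreover have "\<rho> g u \<in> ?R" if "g \<in> carrier G" "u \<in> ?R" for g u
  proof -
    from that obtain a where a: "a \<in> cspace I" "u = A a" by blast
    then have "\<rho> g u = A (\<pi> g a)" using A that(1) by (simp add: intertwiner_def)
    then show ?thesis using linear_op_cspace[OF pi(1)[OF that(1)] a(1)] by simp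
  qed
  ultimately have R: "?R = {\<lambda>_. 0} \<or> ?R = cspace J"
    by (intro irreducible_subspace[OF J]) blast+
  show ?thesis
  proof (cases "?K = cspace I \<or> ?R = {\<lambda>_. 0}")
    case True
    then show ?thesis by blast
  next
    case False
    have "inj_on A (cspace I)"
    proof (rule inj_onI)
      fix u v assume uv: "u \<in> cspace I" "v \<in> cspace I" "A u = A v"
      \<comment> \<open>The difference is written as a sum with \<open>(-1) * v\<close>, because
        \<open>linear_op\<close> provides sums and scalar multiples.\<close>
      have m: "(\<lambda>i. (-1) * v i) \<in> cspace I" using scale[OF uv(2)] by blast
      have "A (\<lambda>i. u i + (-1) * v i) = (\<lambda>_. 0)"
        using linear_op_add[OF lin uv(1) m] linear_op_scale[OF lin uv(2), of "-1"] uv(3) by simp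
      then have "(\<lambda>i. u i + (-1) * v i) \<in> ?K" using add[OF uv(1) m] by simp
      then have "(\<lambda>i. u i + (-1) * v i) = (\<lambda>_. 0)" using K False by blast
      then show "u = v" by (auto simp: fun_eq_iff)
    qed
    then show ?thesis using R False by (auto simp: bij_betw_def)
  qed
qed

section \<open>Intertwining matrices\<close>

text \<open>A matrix \<open>M i j\<close> stands for the operator sending the basis vector \<open>i\<close> to the vector with
  coordinates \<open>M i j\<close>, whereas \<open>\<rho> i' i\<close> has its row index first.\<close>

definition intertwining_matrix ::
  "'i set \<Rightarrow> 'j set \<Rightarrow> ('i \<Rightarrow> 'i \<Rightarrow> complex) \<Rightarrow> ('j \<Rightarrow> 'j \<Rightarrow> complex) \<Rightarrow> ('i \<Rightarrow> 'j \<Rightarrow> complex) \<Rightarrow> bool" where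
  "intertwining_matrix I J \<rho> \<sigma> M \<longleftrightarrow>
     (\<forall>i\<in>I. \<forall>j\<in>J. (\<Sum>i'\<in>I. \<rho> i' i * M i' j) = (\<Sum>j'\<in>J. \<sigma> j j' * M i j'))"

text \<open>The Kronecker product. It pairs arguments factor by factor, so it serves representation
  matrices and intertwiners alike, although their index orders differ.\<close>

definition tensor_mat ::
  "('a \<Rightarrow> 'c \<Rightarrow> complex) \<Rightarrow> ('b \<Rightarrow> 'd \<Rightarrow> complex) \<Rightarrow> 'a \<times> 'b \<Rightarrow> 'c \<times> 'd \<Rightarrow> complex" where
  "tensor_mat \<rho> \<sigma> p q = \<rho> (fst p) (fst q) * \<sigma> (snd p) (snd q)"

text \<open>Orthonormal rows are expressed by the same predicate for the transposed matrix
  \<open>\<lambda>i j. \<rho> j i\<close>.\<close>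

definition orthonormal_columns :: "'i set \<Rightarrow> ('i \<Rightarrow> 'i \<Rightarrow> complex) \<Rightarrow> bool" where
  "orthonormal_columns I \<rho> \<longleftrightarrow>
     (\<forall>i\<in>I. \<forall>i'\<in>I. (\<Sum>k\<in>I. cnj (\<rho> k i) * \<rho> k i') = (if i = i' then 1 else 0))"

lemma sum_tensor:
  "(\<Sum>p\<in>A \<times> B. (f (fst p) * g (snd p) :: complex)) = (\<Sum>a\<in>A. f a) * (\<Sum>b\<in>B. g b)"
  by (simp add: sum_product sum.cartesian_product split_def)

lemma orthonormal_columns_tensor:
  assumes "orthonormal_columns I \<rho>" "orthonormal_columns J \<sigma>"
  shows "orthonormal_columns (I \<times> J) (tensor_mat \<rho> \<sigma>)"
  unfolding orthonormal_columns_def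
proof (intro ballI)
  fix p q assume pq: "p \<in> I \<times> J" "q \<in> I \<times> J"
  have "(\<Sum>k\<in>I \<times> J. cnj (tensor_mat \<rho> \<sigma> k p) * tensor_mat \<rho> \<sigma> k q) =
      (\<Sum>k\<in>I \<times> J. (cnj (\<rho> (fst k) (fst p)) * \<rho> (fst k) (fst q)) *
                   (cnj (\<sigma> (snd k) (snd p)) * \<sigma> (snd k) (snd q)))"
    by (simp add: tensor_mat_def mult_ac)
  also have "\<dots> = (if p = q then 1 else 0)"
    unfolding sum_tensor[where f="\<lambda>k. cnj (\<rho> k (fst p)) * \<rho> k (fst q)"
        and g="\<lambda>k. cnj (\<sigma> k (snd p)) * \<sigma> k (snd q)"]
    using assms pq unfolding orthonormal_columns_def
    by (cases p; cases q) simp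
  finally show "(\<Sum>k\<in>I \<times> J. cnj (tensor_mat \<rho> \<sigma> k p) * tensor_mat \<rho> \<sigma> k q) =
      (if p = q then 1 else 0)" .
qed

lemma intertwining_matrix_comp:
  assumes M: "intertwining_matrix I J \<rho> \<sigma> M" and N: "intertwining_matrix J K \<sigma> \<tau> N"
  shows "intertwining_matrix I K \<rho> \<tau> (\<lambda>i k. \<Sum>j\<in>J. M i j * N j k)"
  unfolding intertwining_matrix_def
proof (intro ballI)
  fix i k assume i: "i \<in> I" and k: "k \<in> K"
  have "(\<Sum>i'\<in>I. \<rho> i' i * (\<Sum>j\<in>J. M i' j * N j k)) =
      (\<Sum>j\<in>J. (\<Sum>i'\<in>I. \<rho> i' i * M i' j) * N j k)"
    by (simp add: sum_distrib_left sum_distrib_right mult.assoc) (rule sum.swap)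
  also have "\<dots> = (\<Sum>j\<in>J. (\<Sum>j'\<in>J. \<sigma> j j' * M i j') * N j k)"
    using M i by (simp add: intertwining_matrix_def)
  also have "\<dots> = (\<Sum>j'\<in>J. M i j' * (\<Sum>j\<in>J. \<sigma> j j' * N j k))"
    by (simp add: sum_distrib_left sum_distrib_right mult_ac) (rule sum.swap)
  also have "\<dots> = (\<Sum>j'\<in>J. M i j' * (\<Sum>k'\<in>K. \<tau> k k' * N j' k'))"
    using N k by (simp add: intertwining_matrix_def)
  also have "\<dots> = (\<Sum>k'\<in>K. \<tau> k k' * (\<Sum>j\<in>J. M i j * N j k'))"
    by (simp add: sum_distrib_left mult_ac) (rule sum.swap)
  finally show "(\<Sum>i'\<in>I. \<rho> i' i * (\<Sum>j\<in>J. M i' j * N j k)) =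
      (\<Sum>k'\<in>K. \<tau> k k' * (\<Sum>j\<in>J. M i j * N j k'))" .
qed

lemma intertwining_matrix_tensor:
  assumes M: "intertwining_matrix I J \<rho> \<sigma> M" and N: "intertwining_matrix I' J' \<rho>' \<sigma>' N"
  shows "intertwining_matrix (I \<times> I') (J \<times> J') (tensor_mat \<rho> \<rho>') (tensor_mat \<sigma> \<sigma>') (tensor_mat M N)"
  unfolding intertwining_matrix_def
proof (intro ballI)
  fix i j assume i: "i \<in> I \<times> I'" and j: "j \<in> J \<times> J'"
  have "(\<Sum>p\<in>I \<times> I'. tensor_mat \<rho> \<rho>' p i * tensor_mat M N p j) =
      (\<Sum>p\<in>I. \<rho> p (fst i) * M p (fst j)) * (\<Sum>p\<in>I'. \<rho>' p (snd i) * N p (snd j))"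
    by (subst sum_tensor[symmetric]) (simp add: tensor_mat_def mult_ac)
  also have "\<dots> = (\<Sum>p\<in>J. \<sigma> (fst j) p * M (fst i) p) * (\<Sum>p\<in>J'. \<sigma>' (snd j) p * N (snd i) p)"
    using M N i j by (auto simp: intertwining_matrix_def)
  also have "\<dots> = (\<Sum>p\<in>J \<times> J'. tensor_mat \<sigma> \<sigma>' j p * tensor_mat M N i p)"
    by (subst sum_tensor[symmetric]) (simp add: tensor_mat_def mult_ac)
  finally show "(\<Sum>p\<in>I \<times> I'. tensor_mat \<rho> \<rho>' p i * tensor_mat M N p j) =
      (\<Sum>p\<in>J \<times> J'. tensor_mat \<sigma> \<sigma>' j p * tensor_mat M N i p)" .
qed

text \<open>Serves to interchange the two middle factors of a fourfold tensor product.\<close>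

lemma intertwining_matrix_reindex:
  assumes M: "intertwining_matrix I J \<rho> \<sigma> M" and h: "bij_betw h K J"
  shows "intertwining_matrix I K \<rho> (\<lambda>k k'. \<sigma> (h k) (h k')) (\<lambda>i k. M i (h k))"
proof -
  have "(\<Sum>k\<in>K. \<sigma> (h k') (h k) * M i (h k)) = (\<Sum>j\<in>J. \<sigma> (h k') j * M i j)" for k' i
    using sum.reindex_bij_betw[OF h, of "\<lambda>j. \<sigma> (h k') j * M i j"] .
  then show ?thesis
    using M h by (auto simp: intertwining_matrix_def dest: bij_betwE)
qed

text \<open>Unitarity moves both representation matrices to the opposite sides of the relation
  before conjugating. This works at a fixed group element, without passing to its inverse.\<close>

lemma intertwining_matrix_adjoint:
  assumes M: "intertwining_matrix I J \<rho> \<sigma> M" and fin: "finite I" "finite J"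
    and rows: "orthonormal_columns I (\<lambda>i j. \<rho> j i)" and cols: "orthonormal_columns J \<sigma>"
  shows "intertwining_matrix J I \<sigma> \<rho> (\<lambda>j i. cnj (M i j))"
  unfolding intertwining_matrix_def
proof (intro ballI)
  fix j i assume j: "j \<in> J" and i: "i \<in> I"
  have row: "(\<Sum>k\<in>I. cnj (\<rho> i k) * \<rho> i' k) = (if i = i' then 1 else 0)" if "i' \<in> I" for i'
    using rows i that by (simp add: orthonormal_columns_def)
  have col: "(\<Sum>k\<in>J. \<sigma> k j' * cnj (\<sigma> k j)) = (if j' = j then 1 else 0)" if "j' \<in> J" for j'
    using cols j that unfolding orthonormal_columns_def by (subst mult.commute) auto
  \<comment> \<open>The intertwining relation solved for \<open>M\<close>, by orthonormality of the
    rows of \<open>\<rho>\<close>.\<close>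
  have M1: "M i q = (\<Sum>k\<in>I. cnj (\<rho> i k) * (\<Sum>q'\<in>J. \<sigma> q q' * M k q'))" if q: "q \<in> J" for q
  proof -
    have "(\<Sum>k\<in>I. cnj (\<rho> i k) * (\<Sum>q'\<in>J. \<sigma> q q' * M k q')) =
        (\<Sum>k\<in>I. cnj (\<rho> i k) * (\<Sum>i'\<in>I. \<rho> i' k * M i' q))"
      using M q by (simp add: intertwining_matrix_def)
    also have "\<dots> = (\<Sum>i'\<in>I. (\<Sum>k\<in>I. cnj (\<rho> i k) * \<rho> i' k) * M i' q)"
      by (simp add: sum_distrib_left sum_distrib_right mult_ac) (rule sum.swap)
    also have "\<dots> = M i q"
      using i fin by (simp add: row if_distrib[of "\<lambda>x. x * _"] cong: if_cong)
    finally show ?thesis by simp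
  qed
  \<comment> \<open>Multiplication by the conjugate of \<open>\<sigma>\<close> cancels the
    \<open>\<sigma>\<close> produced by \<open>M1\<close>, by orthonormality of its columns;
    conjugating the result gives the claim.\<close>
  have "(\<Sum>q\<in>J. M i q * cnj (\<sigma> q j)) =
      (\<Sum>q\<in>J. \<Sum>k\<in>I. \<Sum>q'\<in>J. cnj (\<rho> i k) * \<sigma> q q' * M k q' * cnj (\<sigma> q j))"
    by (simp add: M1 sum_distrib_left sum_distrib_right mult_ac)
  also have "\<dots> = (\<Sum>k\<in>I. \<Sum>q\<in>J. \<Sum>q'\<in>J. cnj (\<rho> i k) * \<sigma> q q' * M k q' * cnj (\<sigma> q j))"
    by (rule sum.swap)
  also have "\<dots> = (\<Sum>k\<in>I. \<Sum>q'\<in>J. \<Sum>q\<in>J. cnj (\<rho> i k) * \<sigma> q q' * M k q' * cnj (\<sigma> q j))"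
    by (intro sum.cong refl sum.swap)
  also have "\<dots> = (\<Sum>k\<in>I. \<Sum>q'\<in>J. cnj (\<rho> i k) * M k q' * (\<Sum>q\<in>J. \<sigma> q q' * cnj (\<sigma> q j)))"
    by (simp add: sum_distrib_left mult_ac)
  also have "\<dots> = (\<Sum>k\<in>I. cnj (\<rho> i k) * M k j)"
    using j fin by (simp add: col if_distrib[of "\<lambda>x. _ * x"] cong: if_cong)
  finally have "cnj (\<Sum>q\<in>J. M i q * cnj (\<sigma> q j)) = cnj (\<Sum>k\<in>I. cnj (\<rho> i k) * M k j)" by simp
  then show "(\<Sum>q\<in>J. \<sigma> q j * cnj (M i q)) = (\<Sum>k\<in>I. \<rho> i k * cnj (M k j))"
    by (simp add: mult.commute)
qed

section \<open>Words and tensor products\<close>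

lemma basis_words_append:
  "basis_words G (ls @ ls') = (\<lambda>(x, y). x @ y) ` (basis_words G ls \<times> basis_words G ls')"
proof (induction ls)
  case Nil
  then show ?case by (auto simp: basis_words_def image_iff)
next
  case (Cons l ls)
  then show ?case
    by (fastforce simp: basis_words_def set_Cons_def image_iff)
qed

lemma length_basis_words: "w \<in> basis_words G ls \<Longrightarrow> length w = length ls"
  by (induction ls arbitrary: w) (auto simp: basis_words_def set_Cons_def)

lemma append_basis_words:
  "x \<in> basis_words G ls \<Longrightarrow> y \<in> basis_words G ls' \<Longrightarrow> x @ y \<in> basis_words G (ls @ ls')"
  by (force simp: basis_words_append)

lemma sum_basis_words_append:
  "(\<Sum>w\<in>basis_words G (ls @ ls'). f w) = (\<Sum>x\<in>basis_words G ls. \<Sum>y\<in>basis_words G ls'. f (x @ y))"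
proof -
  have "inj_on (\<lambda>(x, y). x @ y) (basis_words G ls \<times> basis_words G ls')"
    by (rule inj_onI) (auto dest!: length_basis_words)
  then show ?thesis
    unfolding basis_words_append by (simp add: sum.reindex sum.cartesian_product split_def)
qed

lemma tensor_append:
  assumes "\<And>w. length w \<noteq> n \<Longrightarrow> u w = 0" and "length x = n"
  shows "tensor u v (x @ y) = u x * v y"
proof -
  have "u (take i (x @ y)) * v (drop i (x @ y)) = (if i = n then u x * v y else 0)"
    if "i \<le> length (x @ y)" for i
  proof (cases "i = n")
    case False
    then have "length (take i (x @ y)) \<noteq> n" using that by simp
    then show ?thesis using assms(1) False by simp
  qed (use assms in simp)
  then have "tensor u v (x @ y) = (\<Sum>i\<le>length (x @ y). if i = n then u x * v y else 0)"
    unfolding tensor_def by (intro sum.cong) auto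
  then show ?thesis using assms(2) by simp
qed

lemma tensor_support:
  assumes "\<And>w. length w \<noteq> m \<Longrightarrow> u w = 0" "\<And>w. length w \<noteq> n \<Longrightarrow> v w = 0"
    and "length w \<noteq> m + n"
  shows "tensor u v w = 0"
  unfolding tensor_def
proof (rule sum.neutral, rule ballI)
  fix i assume i: "i \<in> {..length w}"
  show "u (take i w) * v (drop i w) = 0"
  proof (cases "i = m")
    case True
    then have "length (drop i w) \<noteq> n" using i assms(3) by auto
    then show ?thesis using assms(2) by simp
  next
    case False
    then have "length (take i w) \<noteq> m" using i by auto
    then show ?thesis using assms(1) by simp
  qed
qed

lemma tensor_op_append:
  assumes "\<And>a w. a \<in> I \<Longrightarrow> length w \<noteq> length x \<Longrightarrow> A (ket a) w = 0"
  shows "tensor_op I J A B v (x @ y) = (\<Sum>a\<in>I. \<Sum>b\<in>J. v (a @ b) * A (ket a) x * B (ket b) y)"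
  unfolding tensor_op_def
  by (intro sum.cong refl)
     (simp add: tensor_append[where n="length x", OF assms] mult.assoc)

text \<open>\<open>tensor\<close> sums over all cuts of a word. Support on a single length leaves
  just one cut, after the leaves of the left subtree, and this makes the recursion for
  \<open>tree_inj\<close> explicit.\<close>

lemma tree_inj_support:
  "length x = 1 \<Longrightarrow> length w \<noteq> length (leaf_list T) \<Longrightarrow> tree_inj G T \<alpha> (ket x) w = 0"
proof (induction T arbitrary: \<alpha> x w)
  case Leaf
  then show ?case by (auto simp: ket_def)
next
  case (Node l r)
  have "tensor (tree_inj G l (\<lambda>p. \<alpha> (False # p)) (ket a)) (tree_inj G r (\<lambda>p. \<alpha> (True # p)) (ket b)) w = 0"
    if "a \<in> basis_words G [hw \<alpha> [False]]" "b \<in> basis_words G [hw \<alpha> [True]]" for a b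
    by (rule tensor_support[OF Node.IH(1) Node.IH(2)])
       (use that Node.prems(2) in \<open>auto dest: length_basis_words\<close>)
  then show ?case by (simp add: tensor_op_def)
qed

lemma tree_inj_Node_append:
  assumes "length x = length (leaf_list l)"
  shows "tree_inj G (Node l r) \<alpha> v (x @ y) =
    (\<Sum>a\<in>basis_words G [hw \<alpha> [False]]. \<Sum>b\<in>basis_words G [hw \<alpha> [True]].
       coupling_inj G (hw \<alpha> [False]) (hw \<alpha> [True]) (\<alpha> []) v (a @ b) *
       tree_inj G l (\<lambda>p. \<alpha> (False # p)) (ket a) x * tree_inj G r (\<lambda>p. \<alpha> (True # p)) (ket b) y)"
proof -
  have "tree_inj G l (\<lambda>p. \<alpha> (False # p)) (ket a) w = 0"
    if "a \<in> basis_words G [hw \<alpha> [False]]" "length w \<noteq> length x" for a w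
    using tree_inj_support[of a w] that assms by (simp add: length_basis_words[of a])
  then show ?thesis by (simp add: tensor_op_append)
qed

section \<open>Coupling coefficients\<close>

text \<open>The Clebsch-Gordan coefficients of the fixed couplings. The argument is a pair of words
  instead of their concatenation, so that \<open>tensor_mat\<close> applies.\<close>

definition coupling_coeff ::
  "('g, 'e::real_normed_vector, 'l, 'w, 'm) recoupling_data_scheme \<Rightarrow> 'l \<Rightarrow> 'l \<Rightarrow> 'l \<times> nat \<Rightarrow>
   'w list \<Rightarrow> 'w list \<times> 'w list \<Rightarrow> complex" where
  "coupling_coeff G l1 l2 c x p = coupling_inj G l1 l2 c (ket x) (fst p @ snd p)"

definition rep_mat ::
  "('g, 'e::real_normed_vector, 'l, 'w, 'm) recoupling_data_scheme \<Rightarrow> 'l \<Rightarrow> 'g \<Rightarrow>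
   'w list \<Rightarrow> 'w list \<Rightarrow> complex" where
  "rep_mat G l g y x = irrep G l g (ket x) y"

lemma couplings_irreps: "c \<in> couplings G l1 l2 \<Longrightarrow> fst c \<in> irreps G"
  by (auto simp: couplings_def)

lemma summand_incl_ket: "summand_incl c (ket x) = ket (c, x)"
  by (auto simp: summand_incl_def ket_def fun_eq_iff)

lemma coupling_coeff_eq: "coupling_coeff G l1 l2 c x p = coupling_iso G l1 l2 (ket (c, x)) (fst p @ snd p)"
  by (simp add: coupling_coeff_def coupling_inj_def summand_incl_ket)

lemma sum_basis_words_pair:
  "(\<Sum>w\<in>basis_words G [l1, l2]. f w) =
   (\<Sum>p\<in>basis_words G [l1] \<times> basis_words G [l2]. f (fst p @ snd p))"
  using sum_basis_words_append[of f G "[l1]" "[l2]"] by (simp add: sum.cartesian_product split_def)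

lemma append_basis_words_pair:
  "p \<in> basis_words G [l1] \<times> basis_words G [l2] \<Longrightarrow> fst p @ snd p \<in> basis_words G [l1, l2]"
  using append_basis_words[of "fst p" G "[l1]" "snd p" "[l2]"] by auto

section \<open>Orthonormality, completeness and equivariance of the couplings\<close>

context recoupling_setting
begin

lemma irrep_basis:
  assumes "l \<in> irreps G"
  shows "finite (basis_words G [l])" "basis_words G [l] \<noteq> {}"
  using irrep_irreducible[OF assms] by (simp_all add: irreducible_rep_def fd_representation_def)

lemma irrep_linear:
  "l \<in> irreps G \<Longrightarrow> g \<in> carrier G \<Longrightarrow> linear_op (basis_words G [l]) (basis_words G [l]) (irrep G l g)"
  using irrep_unitary unfolding unitary_op_def by blast

lemma finite_basis_words: "set ls \<subseteq> irreps G \<Longrightarrow> finite (basis_words G ls)"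
proof (induction ls)
  case Nil
  then show ?case by (simp add: basis_words_def)
next
  case (Cons l ls)
  then show ?case using irrep_basis(1)[of l] basis_words_append[of G "[l]" ls] by auto
qed

lemma rep_mat_columns:
  "l \<in> irreps G \<Longrightarrow> g \<in> carrier G \<Longrightarrow> orthonormal_columns (basis_words G [l]) (rep_mat G l g)"
  unfolding orthonormal_columns_def rep_mat_def
  using unitary_op_columns[OF irrep_unitary irrep_basis(1)] by blast

lemma rep_mat_rows:
  assumes "l \<in> irreps G" "g \<in> carrier G"
  shows "orthonormal_columns (basis_words G [l]) (\<lambda>y x. rep_mat G l g x y)"
  unfolding orthonormal_columns_def rep_mat_def
  using unitary_op_rows[OF irrep_unitary[OF assms] irrep_basis(1) irrep_basis(1), OF assms(1,1)]
  by (subst mult.commute) auto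

text \<open>A sum over an infinite set is 0 by convention, so on an infinite index set
  \<open>cinner\<close> would vanish identically. The unitary \<open>coupling_iso\<close> has to map
  some vector to a basis vector of the nonzero tensor product, which has norm 1.\<close>

lemma finite_sum_basis:
  assumes "l1 \<in> irreps G" "l2 \<in> irreps G"
  shows "finite (sum_basis G l1 l2)"
proof (rule ccontr)
  assume inf: "infinite (sum_basis G l1 l2)"
  have fin: "finite (basis_words G [l1, l2])" using assms by (simp add: finite_basis_words)
  obtain x y where "x \<in> basis_words G [l1]" "y \<in> basis_words G [l2]"
    using assms irrep_basis(2) by blast
  then have w: "x @ y \<in> basis_words G [l1, l2]" using append_basis_words_pair[of "(x, y)" G l1 l2] by simp
  note U = coupling_iso_unitary[OF assms]
  obtain u where "u \<in> cspace (sum_basis G l1 l2)" "ket (x @ y) = coupling_iso G l1 l2 u"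
    using U ket_in_cspace[OF w] unfolding unitary_op_def by (metis imageE)
  then have "cinner (basis_words G [l1, l2]) (ket (x @ y)) (ket (x @ y)) = cinner (sum_basis G l1 l2) u u"
    using U by (simp add: unitary_op_def)
  moreover have "cinner (sum_basis G l1 l2) u u = 0" using inf by (simp add: cinner_def)
  ultimately show False using cinner_ket[OF fin w, of "ket (x @ y)"] by (simp add: ket_def)
qed

lemma finite_couplings:
  assumes "l1 \<in> irreps G" "l2 \<in> irreps G"
  shows "finite (couplings G l1 l2)"
proof (rule finite_subset)
  show "couplings G l1 l2 \<subseteq> fst ` sum_basis G l1 l2"
    using irrep_basis(2)[OF couplings_irreps] by (force simp: sum_basis_def)
  show "finite (fst ` sum_basis G l1 l2)" using finite_sum_basis[OF assms] by simp
qed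

lemma coupling_coeff_orthonormal:
  assumes "l1 \<in> irreps G" "l2 \<in> irreps G" and "c \<in> couplings G l1 l2" "c' \<in> couplings G l1 l2"
    and "x \<in> basis_words G [fst c]" "x' \<in> basis_words G [fst c']"
  shows "(\<Sum>p\<in>basis_words G [l1] \<times> basis_words G [l2].
      cnj (coupling_coeff G l1 l2 c x p) * coupling_coeff G l1 l2 c' x' p) =
    (if c = c' \<and> x = x' then 1 else 0)"
  using unitary_op_columns[OF coupling_iso_unitary[OF assms(1,2)] finite_sum_basis[OF assms(1,2)],
      of "(c, x)" "(c', x')"] assms(3-6)
  by (simp add: sum_basis_words_pair coupling_coeff_eq sum_basis_def)

lemma coupling_coeff_complete:
  assumes "l1 \<in> irreps G" "l2 \<in> irreps G" and p: "p \<in> basis_words G [l1] \<times> basis_words G [l2]"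
  shows "h p = (\<Sum>c\<in>couplings G l1 l2. \<Sum>x\<in>basis_words G [fst c].
    (\<Sum>q\<in>basis_words G [l1] \<times> basis_words G [l2]. cnj (coupling_coeff G l1 l2 c x q) * h q) *
    coupling_coeff G l1 l2 c x p)"
proof -
  \<comment> \<open>Completeness is available for functions on two-letter words; \<open>h'\<close>
    transports the pair function \<open>h\<close> there by cutting after the first letter.\<close>
  define h' where "h' w = (if w \<in> basis_words G [l1, l2] then h (take 1 w, drop 1 w) else 0)" for w
  have h': "h' (fst q @ snd q) = h q" if "q \<in> basis_words G [l1] \<times> basis_words G [l2]" for q
  proof -
    have "length (fst q) = 1" using that length_basis_words[of "fst q" G "[l1]"] by auto
    then show ?thesis using append_basis_words_pair[OF that] by (simp add: h'_def)
  qed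
  have "h' \<in> cspace (basis_words G [l1, l2])" by (simp add: h'_def cspace_def)
  from unitary_op_complete[OF coupling_iso_unitary[OF assms(1,2)] finite_sum_basis[OF assms(1,2)] this,
      of "fst p @ snd p"]
  have "h p = (\<Sum>i\<in>sum_basis G l1 l2.
      (\<Sum>q\<in>basis_words G [l1] \<times> basis_words G [l2]. cnj (coupling_iso G l1 l2 (ket i) (fst q @ snd q)) * h q) *
      coupling_iso G l1 l2 (ket i) (fst p @ snd p))"
    by (simp add: h' p sum_basis_words_pair cong: sum.cong)
  also have "\<dots> = (\<Sum>c\<in>couplings G l1 l2. \<Sum>x\<in>basis_words G [fst c].
    (\<Sum>q\<in>basis_words G [l1] \<times> basis_words G [l2]. cnj (coupling_coeff G l1 l2 c x q) * h q) *
    coupling_coeff G l1 l2 c x p)"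
    unfolding sum_basis_def
    by (subst sum.Sigma)
       (auto simp: coupling_coeff_eq split_def finite_couplings assms irrep_basis couplings_irreps
         intro!: irrep_basis(1) couplings_irreps)
  finally show ?thesis .
qed

text \<open>Both sides compute \<open>coupling_iso\<close> at the image of \<open>ket (c, x)\<close>
  under \<open>sum_rep\<close>: expanding that image leaves only the summand \<open>c\<close>, while
  equivariance brings the pair representation in front.\<close>

lemma coupling_coeff_intertwining:
  assumes l: "l1 \<in> irreps G" "l2 \<in> irreps G" and c: "c \<in> couplings G l1 l2" and g: "g \<in> carrier G"
  shows "intertwining_matrix (basis_words G [fst c]) (basis_words G [l1] \<times> basis_words G [l2])
    (rep_mat G (fst c) g) (tensor_mat (rep_mat G l1 g) (rep_mat G l2 g)) (coupling_coeff G l1 l2 c)"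
  unfolding intertwining_matrix_def
proof (intro ballI)
  fix x p assume x: "x \<in> basis_words G [fst c]"
    and p: "p \<in> basis_words G [l1] \<times> basis_words G [l2]"
  let ?A = "coupling_iso G l1 l2" and ?S = "sum_basis G l1 l2"
  have cx: "(c, x') \<in> ?S" if "x' \<in> basis_words G [fst c]" for x'
    using c that by (simp add: sum_basis_def)
  have fc: "fst c \<in> irreps G" using c by (rule couplings_irreps)
  define v where "v = sum_rep G l1 l2 g (ket (c, x))"
  have v: "v (c', y) = (if c' = c then rep_mat G (fst c) g y x else 0)"
    if "(c', y) \<in> ?S" for c' y
  proof -
    have c': "c' \<in> couplings G l1 l2" using that by (simp add: sum_basis_def)
    have "(\<lambda>vs. ket (c, x) (c', vs)) = (if c' = c then ket x else (\<lambda>_. 0))"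
      by (auto simp: ket_def)
    then show ?thesis
      using c' linear_op_zero[OF irrep_linear[OF couplings_irreps[OF c'] g]]
      by (simp add: v_def sum_rep_def rep_mat_def)
  qed
  have v_cspace: "v \<in> cspace ?S"
  proof -
    have "irrep G (fst c') g (\<lambda>vs. ket (c, x) (c', vs)) \<in> cspace (basis_words G [fst c'])"
      if "c' \<in> couplings G l1 l2" for c'
      by (rule linear_op_cspace[OF irrep_linear[OF couplings_irreps[OF that] g]])
         (use x in \<open>auto simp: cspace_def ket_def\<close>)
    then show ?thesis by (auto simp: v_def sum_rep_def cspace_def sum_basis_def)
  qed
  have lin: "linear_op ?S (basis_words G [l1, l2]) ?A"
    using coupling_iso_unitary[OF l] by (simp add: unitary_op_def)
  have "?A v (fst p @ snd p) = (\<Sum>i\<in>?S. v i * ?A (ket i) (fst p @ snd p))"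
    using linear_op_expand[OF lin finite_sum_basis[OF l] v_cspace] by simp
  also have "\<dots> = (\<Sum>c'\<in>couplings G l1 l2. \<Sum>y\<in>basis_words G [fst c'].
      v (c', y) * ?A (ket (c', y)) (fst p @ snd p))"
    unfolding sum_basis_def
    by (subst sum.Sigma) (auto simp: split_def finite_couplings l intro!: irrep_basis(1) couplings_irreps)
  also have "\<dots> = (\<Sum>c'\<in>couplings G l1 l2. if c' = c then \<Sum>y\<in>basis_words G [fst c].
      rep_mat G (fst c) g y x * coupling_coeff G l1 l2 c y p else 0)"
    by (intro sum.cong refl) (auto simp: v coupling_coeff_eq sum_basis_def)
  also have "\<dots> = (\<Sum>y\<in>basis_words G [fst c]. rep_mat G (fst c) g y x * coupling_coeff G l1 l2 c y p)"
    using c finite_couplings[OF l] by simp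
  finally have left: "?A v (fst p @ snd p) = \<dots>" .
  have "?A v (fst p @ snd p) = pair_rep G l1 l2 g (?A (ket (c, x))) (fst p @ snd p)"
    using coupling_iso_equivariant[OF l] g ket_in_cspace[OF cx[OF x]]
    by (simp add: v_def intertwiner_def)
  also have "\<dots> = (\<Sum>q\<in>basis_words G [l1] \<times> basis_words G [l2].
      tensor_mat (rep_mat G l1 g) (rep_mat G l2 g) p q * coupling_coeff G l1 l2 c x q)"
  proof -
    have len: "length (fst p) = 1" using p length_basis_words[of "fst p" G "[l1]"] by auto
    have "irrep G l1 g (ket a) w = 0" if "a \<in> basis_words G [l1]" "length w \<noteq> length (fst p)" for a w
      using linear_op_cspace[OF irrep_linear[OF l(1) g] ket_in_cspace[OF that(1)]] that(2) len
        length_basis_words[of w G "[l1]"]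
      by (auto simp: cspace_def)
    then show ?thesis
      by (simp add: pair_rep_def tensor_op_append sum.cartesian_product split_def
          tensor_mat_def rep_mat_def coupling_coeff_eq mult_ac)
  qed
  finally show "(\<Sum>i'\<in>basis_words G [fst c]. rep_mat G (fst c) g i' x * coupling_coeff G l1 l2 c i' p) =
    (\<Sum>q\<in>basis_words G [l1] \<times> basis_words G [l2].
      tensor_mat (rep_mat G l1 g) (rep_mat G l2 g) p q * coupling_coeff G l1 l2 c x q)"
    using left by simp
qed

text \<open>Both halves of Schur's lemma at once: for equal labels the operator of \<open>M\<close>
  is scalar, and for different labels a bijection would contradict inequivalence of the chosen
  irreps.\<close>

lemma intertwining_matrix_schur:
  assumes l: "l \<in> irreps G" "l' \<in> irreps G"
    and M: "\<And>g. g \<in> carrier G \<Longrightarrow>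
      intertwining_matrix (basis_words G [l]) (basis_words G [l']) (rep_mat G l g) (rep_mat G l' g) M"
  shows "\<exists>r. \<forall>x\<in>basis_words G [l]. \<forall>y\<in>basis_words G [l']. M x y = (if l = l' \<and> x = y then r else 0)"
proof -
  let ?B = "basis_words G [l]" and ?B' = "basis_words G [l']"
  note fin = irrep_basis(1)[OF l(1)] irrep_basis(1)[OF l(2)]
  \<comment> \<open>The matrix is turned back into an operator; the value 0 outside the target basis
    puts the image into its \<open>cspace\<close>.\<close>
  define A where "A v = (\<lambda>y. if y \<in> ?B' then \<Sum>x\<in>?B. v x * M x y else 0)" for v :: "'w list \<Rightarrow> complex"
  have lin: "linear_op ?B ?B' A"
    unfolding linear_op_def A_def
    by (auto simp: cspace_def fun_eq_iff distrib_right sum.distrib sum_distrib_left mult.assoc)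
  have ket: "A (ket x) y = M x y" if "x \<in> ?B" "y \<in> ?B'" for x y
    using that fin by (simp add: A_def ket_def if_distrib[of "\<lambda>x. x * _"] cong: if_cong)
  have tw: "intertwiner G ?B (irrep G l) ?B' (irrep G l') A"
    unfolding intertwiner_def
  proof (intro conjI lin ballI)
    fix g v assume g: "g \<in> carrier G" and v: "v \<in> cspace ?B"
    have lv: "irrep G l g v x' = (\<Sum>x\<in>?B. v x * rep_mat G l g x' x)" for x'
      using linear_op_expand[OF irrep_linear[OF l(1) g] fin(1) v] by (simp add: rep_mat_def)
    have Av: "A v \<in> cspace ?B'" by (rule linear_op_cspace[OF lin v])
    have lAv: "irrep G l' g (A v) y = (\<Sum>y'\<in>?B'. A v y' * rep_mat G l' g y y')" for y
      using linear_op_expand[OF irrep_linear[OF l(2) g] fin(2) Av] by (simp add: rep_mat_def)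
    have zero: "irrep G l' g (A v) y = 0" if "y \<notin> ?B'" for y
      using linear_op_cspace[OF irrep_linear[OF l(2) g] Av] that by (simp add: cspace_def)
    have "A (irrep G l g v) y = irrep G l' g (A v) y" if y: "y \<in> ?B'" for y
    proof -
      have "A (irrep G l g v) y = (\<Sum>x\<in>?B. v x * (\<Sum>x'\<in>?B. rep_mat G l g x' x * M x' y))"
        using y by (simp add: A_def lv sum_distrib_left sum_distrib_right mult_ac) (rule sum.swap)
      also have "\<dots> = (\<Sum>x\<in>?B. v x * (\<Sum>y'\<in>?B'. rep_mat G l' g y y' * M x y'))"
        using M[OF g] y by (simp add: intertwining_matrix_def)
      also have "\<dots> = irrep G l' g (A v) y"
        by (simp add: lAv) (simp add: A_def sum_distrib_left sum_distrib_right mult_ac, rule sum.swap)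
      finally show ?thesis .
    qed
    then show "A (irrep G l g v) = irrep G l' g (A v)"
      using zero by (auto simp: fun_eq_iff) (simp add: A_def)
  qed
  show ?thesis
  proof (cases "l = l'")
    case True
    then obtain r where r: "\<forall>v\<in>cspace ?B. A v = (\<lambda>i. r * v i)"
      using schur_scalar[OF irrep_irreducible[OF l(1)]] tw by blast
    have "M x y = (if x = y then r else 0)" if "x \<in> ?B" "y \<in> ?B'" for x y
      using ket[OF that] r ket_in_cspace[OF that(1)] by (auto simp: ket_def)
    then show ?thesis using True by auto
  next
    case False
    then have "\<not> bij_betw A (cspace ?B) (cspace ?B')"
      using irrep_inequivalent[OF l] tw unfolding equivalent_rep_def by blast
    then have "\<forall>v\<in>cspace ?B. A v = (\<lambda>_. 0)"
      using schur_zero_or_bij[OF irrep_irreducible[OF l(1)] irrep_irreducible[OF l(2)] tw] by blast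
    then have "M x y = 0" if "x \<in> ?B" "y \<in> ?B'" for x y
      using ket[OF that] ket_in_cspace[OF that(1)] by simp
    then show ?thesis using False by auto
  qed
qed

end

section \<open>Overlaps of coupling trees\<close>

text \<open>The leaf order of \<open>leaf_dup\<close>, in which the two leaves attached at a leaf of
  the tree are neighbours. It is applied to words of equal length.\<close>

fun interleave :: "'a list \<Rightarrow> 'a list \<Rightarrow> 'a list" where
  "interleave (a # as) (b # bs) = a # b # interleave as bs"
| "interleave _ _ = []"

lemma interleave_append:
  "length u = length v \<Longrightarrow> interleave (u @ u') (v @ v') = interleave u v @ interleave u' v'"
  by (induction u v rule: list_induct2) auto

lemma length_interleave: "length u = length v \<Longrightarrow> length (interleave u v) = 2 * length u"
  by (induction u v rule: list_induct2) auto

text \<open>The matrix of \<open>(i\<^sub>\<alpha>\<^sub>1 \<otimes> i\<^sub>\<alpha>\<^sub>2)\<^sup>* \<Pi> i\<close>, where the last factor is the injection of the duplicated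
  tree; \<open>node_overlap\<close> below is the recursion that it satisfies.\<close>

definition tree_overlap ::
  "('g, 'e::real_normed_vector, 'l, 'w, 'm) recoupling_data_scheme \<Rightarrow> btree \<Rightarrow>
   'l labelling \<Rightarrow> 'l labelling \<Rightarrow> 'l labelling \<Rightarrow> (vertex \<Rightarrow> nat) \<Rightarrow>
   'w list \<Rightarrow> 'w list \<times> 'w list \<Rightarrow> complex" where
  "tree_overlap G T \<alpha>1 \<alpha>2 \<alpha>3 ks x p =
     (\<Sum>u\<in>basis_words G (leaf_weights T \<alpha>1). \<Sum>v\<in>basis_words G (leaf_weights T \<alpha>2).
        cnj (tree_inj G T \<alpha>1 (ket (fst p)) u) * cnj (tree_inj G T \<alpha>2 (ket (snd p)) v) *
        tree_inj G (leaf_dup T) (dup_label T \<alpha>1 \<alpha>2 \<alpha>3 ks) (ket x) (interleave u v))"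

abbreviation child_pairs ::
  "('g, 'e::real_normed_vector, 'l, 'w, 'm) recoupling_data_scheme \<Rightarrow> 'l labelling \<Rightarrow>
   ('w list \<times> 'w list) set" where
  "child_pairs G \<alpha> \<equiv> basis_words G [hw \<alpha> [False]] \<times> basis_words G [hw \<alpha> [True]]"

abbreviation root_coeff ::
  "('g, 'e::real_normed_vector, 'l, 'w, 'm) recoupling_data_scheme \<Rightarrow> 'l labelling \<Rightarrow>
   'w list \<Rightarrow> 'w list \<times> 'w list \<Rightarrow> complex" where
  "root_coeff G \<alpha> \<equiv> coupling_coeff G (hw \<alpha> [False]) (hw \<alpha> [True]) (\<alpha> [])"

text \<open>\<open>X\<close> and \<open>Y\<close> are left free so that overlaps of subtrees and
  single couplings can both be inserted; bilinearity in them carries expansions of the children to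
  the node.\<close>

definition node_overlap ::
  "('g, 'e::real_normed_vector, 'l, 'w, 'm) recoupling_data_scheme \<Rightarrow>
   'l labelling \<Rightarrow> 'l labelling \<Rightarrow> 'l labelling \<Rightarrow>
   ('w list \<Rightarrow> 'w list \<times> 'w list \<Rightarrow> complex) \<Rightarrow> ('w list \<Rightarrow> 'w list \<times> 'w list \<Rightarrow> complex) \<Rightarrow>
   'w list \<Rightarrow> 'w list \<times> 'w list \<Rightarrow> complex" where
  "node_overlap G \<alpha>1 \<alpha>2 \<alpha>3 X Y x p =
     (\<Sum>p1\<in>child_pairs G \<alpha>1. \<Sum>p2\<in>child_pairs G \<alpha>2. \<Sum>p3\<in>child_pairs G \<alpha>3.
        cnj (root_coeff G \<alpha>1 (fst p) p1) * cnj (root_coeff G \<alpha>2 (snd p) p2) * root_coeff G \<alpha>3 x p3 *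
        X (fst p3) (fst p1, fst p2) * Y (snd p3) (snd p1, snd p2))"

section \<open>The recursion of overlaps along the tree\<close>

lemma leaves_simps [simp]:
  "leaves Leaf = {[]}"
  "leaves (Node l r) = Cons False ` leaves l \<union> Cons True ` leaves r"
  by (simp_all add: leaves_def)

lemma nodes_Int_leaves: "nodes T \<inter> leaves T = {}"
  by (induction T) auto

lemma root_vertex: "[] \<in> nodes T \<union> leaves T"
  by (cases T) auto

lemma dup_label_root [simp]: "fst (dup_label T \<alpha>1 \<alpha>2 \<alpha>3 ks []) = hw \<alpha>3 []"
  using root_vertex[of T] by (auto simp: dup_label_def)

lemma dup_label_child:
  "dup_label (Node l r) \<alpha>1 \<alpha>2 \<alpha>3 ks (b # p) =
   dup_label (if b then r else l) (\<lambda>p. \<alpha>1 (b # p)) (\<lambda>p. \<alpha>2 (b # p)) (\<lambda>p. \<alpha>3 (b # p))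
     (\<lambda>p. ks (b # p)) p"
proof (cases "p = []")
  case True
  \<comment> \<open>The root of a subtree is a node or a leaf, so the branch of
    \<open>dup_label\<close> with \<open>butlast\<close>, which would strip \<open>b\<close> itself,
    is not reached.\<close>
  then show ?thesis using root_vertex[of l] root_vertex[of r] by (auto simp: dup_label_def)
next
  case False
  then show ?thesis by (auto simp: dup_label_def)
qed

lemma leaf_weights_Node:
  "leaf_weights (Node l r) \<alpha> =
   leaf_weights l (\<lambda>p. \<alpha> (False # p)) @ leaf_weights r (\<lambda>p. \<alpha> (True # p))"
  by (simp add: leaf_weights_def comp_def)

lemma length_leaf_weights [simp]: "length (leaf_weights T \<alpha>) = length (leaf_list T)"
  by (simp add: leaf_weights_def)

lemma length_leaf_dup: "length (leaf_list (leaf_dup T)) = 2 * length (leaf_list T)"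
  by (induction T) auto

lemma tree_inj_Node_root_coeff:
  assumes "length u = length (leaf_list l)"
  shows "tree_inj G (Node l r) \<alpha> (ket x) (u @ v) =
    (\<Sum>p\<in>child_pairs G \<alpha>. root_coeff G \<alpha> x p *
       tree_inj G l (\<lambda>p. \<alpha> (False # p)) (ket (fst p)) u * tree_inj G r (\<lambda>p. \<alpha> (True # p)) (ket (snd p)) v)"
  by (simp only: tree_inj_Node_append[OF assms] sum.cartesian_product split_def coupling_coeff_def)

text \<open>Words of the left subtree (\<open>u\<close>, \<open>v\<close>) and of the right subtree
  (\<open>u'\<close>, \<open>v'\<close>) interact only through the index \<open>q\<close> of the
  root couplings, so for fixed \<open>q\<close> the sums factor.\<close>

lemma sum_separate:
  fixes L R :: "'q \<Rightarrow> 'u \<Rightarrow> 'v \<Rightarrow> complex"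
  shows "(\<Sum>u\<in>U. \<Sum>u'\<in>U'. \<Sum>v\<in>V. \<Sum>v'\<in>V'. \<Sum>q\<in>Q. K q * L q u v * R' q u' v') =
    (\<Sum>q\<in>Q. K q * (\<Sum>u\<in>U. \<Sum>v\<in>V. L q u v) * (\<Sum>u'\<in>U'. \<Sum>v'\<in>V'. R' q u' v'))"
proof -
  have "(\<Sum>u\<in>U. \<Sum>u'\<in>U'. \<Sum>v\<in>V. \<Sum>v'\<in>V'. \<Sum>q\<in>Q. K q * L q u v * R' q u' v') =
      (\<Sum>u\<in>U. \<Sum>v\<in>V. \<Sum>u'\<in>U'. \<Sum>v'\<in>V'. \<Sum>q\<in>Q. K q * L q u v * R' q u' v')"
    by (intro sum.cong refl sum.swap)
  also have "\<dots> = (\<Sum>a\<in>U \<times> V. \<Sum>b\<in>U' \<times> V'. \<Sum>q\<in>Q. K q * L q (fst a) (snd a) * R' q (fst b) (snd b))"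
    by (simp only: sum.cartesian_product[where A=U and B=V] sum.cartesian_product[where A=U' and B=V']
        split_def)
  also have "\<dots> = (\<Sum>a\<in>U \<times> V. \<Sum>q\<in>Q. \<Sum>b\<in>U' \<times> V'. K q * L q (fst a) (snd a) * R' q (fst b) (snd b))"
    by (intro sum.cong refl sum.swap)
  also have "\<dots> = (\<Sum>q\<in>Q. \<Sum>a\<in>U \<times> V. \<Sum>b\<in>U' \<times> V'. K q * L q (fst a) (snd a) * R' q (fst b) (snd b))"
    by (rule sum.swap)
  also have "\<dots> = (\<Sum>q\<in>Q. K q * (\<Sum>a\<in>U \<times> V. L q (fst a) (snd a)) * (\<Sum>b\<in>U' \<times> V'. R' q (fst b) (snd b)))"
    by (simp only: mult.assoc sum_product) (simp only: sum_distrib_left)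
  finally show ?thesis by (simp add: sum.cartesian_product split_def)
qed

text \<open>The duplicate of a leaf is a cherry and the injections of the two copies are identities,
  so contraction reads off one entry of the coupling at that leaf.\<close>

lemma tree_overlap_Leaf:
  assumes "finite (basis_words G [hw \<alpha>1 []])" "finite (basis_words G [hw \<alpha>2 []])"
    and p: "p \<in> basis_words G [hw \<alpha>1 []] \<times> basis_words G [hw \<alpha>2 []]"
  shows "tree_overlap G Leaf \<alpha>1 \<alpha>2 \<alpha>3 ks x p =
    coupling_coeff G (hw \<alpha>1 []) (hw \<alpha>2 []) (hw \<alpha>3 [], ks []) x p"
proof -
  let ?B1 = "basis_words G [hw \<alpha>1 []]" and ?B2 = "basis_words G [hw \<alpha>2 []]"
  let ?d = "dup_label Leaf \<alpha>1 \<alpha>2 \<alpha>3 ks"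
  have d: "?d [] = (hw \<alpha>3 [], ks [])" "?d [False] = \<alpha>1 []" "?d [True] = \<alpha>2 []"
    by (auto simp: dup_label_def)
  have pick: "(\<Sum>a\<in>A. ket a' a * f a) = f a'" "(\<Sum>a\<in>A. f a * ket a a') = f a'"
    if "finite A" "a' \<in> A" for A and a' :: "'w list" and f :: "'w list \<Rightarrow> complex"
    using that by (simp_all add: ket_def if_distrib[of "\<lambda>x. x * _"] if_distrib[of "\<lambda>x. _ * x"] cong: if_cong)
  have dup: "tree_inj G (leaf_dup Leaf) ?d (ket x) (interleave u v) =
      coupling_coeff G (hw \<alpha>1 []) (hw \<alpha>2 []) (hw \<alpha>3 [], ks []) x (u, v)"
    if u: "u \<in> ?B1" and v: "v \<in> ?B2" for u v
  proof -
    have len: "length u = 1" "length v = 1"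
      using u v by (auto dest: length_basis_words)
    have "interleave u v = u @ v"
      using len by (cases u; cases v) auto
    then have "tree_inj G (leaf_dup Leaf) ?d (ket x) (interleave u v) =
        (\<Sum>a\<in>?B1. \<Sum>b\<in>?B2. coupling_inj G (hw \<alpha>1 []) (hw \<alpha>2 []) (hw \<alpha>3 [], ks []) (ket x) (a @ b) * ket a u * ket b v)"
      using tree_inj_Node_append[of u Leaf G Leaf ?d "ket x" v] len d by simp
    then show ?thesis
      using pick(2)[OF assms(1) u] pick(2)[OF assms(2) v] by (simp add: coupling_coeff_def)
  qed
  have cnjket: "cnj (ket a b) = ket a b" for a b :: "'w list" by (simp add: ket_def)
  have "tree_overlap G Leaf \<alpha>1 \<alpha>2 \<alpha>3 ks x p = (\<Sum>u\<in>?B1. ket (fst p) u * (\<Sum>v\<in>?B2. ket (snd p) v *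
      coupling_coeff G (hw \<alpha>1 []) (hw \<alpha>2 []) (hw \<alpha>3 [], ks []) x (u, v)))"
    unfolding tree_overlap_def leaf_weights_def
    by (simp add: dup cnjket sum_distrib_left mult.assoc del: leaf_dup.simps)
  then show ?thesis using pick(1)[OF assms(1)] pick(1)[OF assms(2)] p by auto
qed

text \<open>All leaf words are cut between the two subtrees. Each of the three injections then
  contributes its root coupling, and what remains is a product of an overlap for \<open>l\<close>
  and one for \<open>r\<close>.\<close>

lemma tree_overlap_Node:
  fixes G :: "('g, 'e::real_normed_vector, 'l, 'w, 'm) recoupling_data_scheme"
    and \<alpha>1 \<alpha>2 \<alpha>3 :: "'l labelling"
  shows "tree_overlap G (Node l r) \<alpha>1 \<alpha>2 \<alpha>3 ks x p =
   node_overlap G \<alpha>1 \<alpha>2 \<alpha>3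
     (tree_overlap G l (\<lambda>p. \<alpha>1 (False # p)) (\<lambda>p. \<alpha>2 (False # p)) (\<lambda>p. \<alpha>3 (False # p)) (\<lambda>p. ks (False # p)))
     (tree_overlap G r (\<lambda>p. \<alpha>1 (True # p)) (\<lambda>p. \<alpha>2 (True # p)) (\<lambda>p. \<alpha>3 (True # p)) (\<lambda>p. ks (True # p))) x p"
proof -
  define W where "W b \<alpha> = basis_words G (leaf_weights (if b then r else l) (\<lambda>p. \<alpha> (b # p)))"
    for b :: bool and \<alpha> :: "'l labelling"
  define t where "t b \<alpha> = tree_inj G (if b then r else l) (\<lambda>p. \<alpha> (b # p))"
    for b :: bool and \<alpha> :: "'l labelling"
  define d where "d b = tree_inj G (leaf_dup (if b then r else l))
    (dup_label (if b then r else l) (\<lambda>p. \<alpha>1 (b # p)) (\<lambda>p. \<alpha>2 (b # p)) (\<lambda>p. \<alpha>3 (b # p)) (\<lambda>p. ks (b # p)))"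
    for b :: bool
  let ?D = "dup_label (Node l r) \<alpha>1 \<alpha>2 \<alpha>3 ks"
  have len: "length u = length (leaf_list l)" if "u \<in> W False \<alpha>" for u \<alpha>
    using that length_basis_words by (fastforce simp: W_def)
  have t: "tree_inj G (Node l r) \<alpha> (ket y) (u @ v) =
      (\<Sum>q\<in>child_pairs G \<alpha>. root_coeff G \<alpha> y q * t False \<alpha> (ket (fst q)) u * t True \<alpha> (ket (snd q)) v)"
    if "u \<in> W False \<alpha>" for u v \<alpha> y
    using tree_inj_Node_root_coeff[OF len[OF that]] by (simp add: t_def)
  \<comment> \<open>Interleaving respects the cut because \<open>u\<close> and \<open>v\<close> have
    the same length, the number of leaves of \<open>l\<close>.\<close>
  have d: "tree_inj G (leaf_dup (Node l r)) ?D (ket x) (interleave (u @ u') (v @ v')) =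
      (\<Sum>q\<in>child_pairs G \<alpha>3. root_coeff G \<alpha>3 x q * d False (ket (fst q)) (interleave u v) *
         d True (ket (snd q)) (interleave u' v'))"
    if "u \<in> W False \<alpha>1" "v \<in> W False \<alpha>2" for u u' v v'
  proof -
    have "length (interleave u v) = length (leaf_list (leaf_dup l))"
      using len[OF that(1)] len[OF that(2)] by (simp add: length_interleave length_leaf_dup)
    moreover have root: "?D [] = \<alpha>3 []" by (simp add: dup_label_def)
    ultimately show ?thesis
      using len[OF that(1)] len[OF that(2)]
        tree_inj_Node_root_coeff[of _ "leaf_dup l" G "leaf_dup r" ?D x "interleave u' v'"]
      by (simp only: interleave_append leaf_dup.simps)
         (simp add: dup_label_child d_def root)
  qed
  have "tree_overlap G (Node l r) \<alpha>1 \<alpha>2 \<alpha>3 ks x p =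
    (\<Sum>u\<in>W False \<alpha>1. \<Sum>u'\<in>W True \<alpha>1. \<Sum>v\<in>W False \<alpha>2. \<Sum>v'\<in>W True \<alpha>2.
       cnj (tree_inj G (Node l r) \<alpha>1 (ket (fst p)) (u @ u')) * cnj (tree_inj G (Node l r) \<alpha>2 (ket (snd p)) (v @ v')) *
       tree_inj G (leaf_dup (Node l r)) ?D (ket x) (interleave (u @ u') (v @ v')))"
    unfolding tree_overlap_def leaf_weights_Node sum_basis_words_append W_def by simp
  also have "\<dots> =
    (\<Sum>u\<in>W False \<alpha>1. \<Sum>u'\<in>W True \<alpha>1. \<Sum>v\<in>W False \<alpha>2. \<Sum>v'\<in>W True \<alpha>2.
      (\<Sum>p1\<in>child_pairs G \<alpha>1. cnj (root_coeff G \<alpha>1 (fst p) p1) * cnj (t False \<alpha>1 (ket (fst p1)) u) * cnj (t True \<alpha>1 (ket (snd p1)) u')) *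
      (\<Sum>p2\<in>child_pairs G \<alpha>2. cnj (root_coeff G \<alpha>2 (snd p) p2) * cnj (t False \<alpha>2 (ket (fst p2)) v) * cnj (t True \<alpha>2 (ket (snd p2)) v')) *
      (\<Sum>p3\<in>child_pairs G \<alpha>3. root_coeff G \<alpha>3 x p3 * d False (ket (fst p3)) (interleave u v) * d True (ket (snd p3)) (interleave u' v')))"
    by (intro sum.cong refl arg_cong2[where f="(*)"]) (simp_all only: t d cnj_sum complex_cnj_mult)
  also have "\<dots> =
    (\<Sum>u\<in>W False \<alpha>1. \<Sum>u'\<in>W True \<alpha>1. \<Sum>v\<in>W False \<alpha>2. \<Sum>v'\<in>W True \<alpha>2.
      \<Sum>q\<in>child_pairs G \<alpha>1 \<times> child_pairs G \<alpha>2 \<times> child_pairs G \<alpha>3.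
        (cnj (root_coeff G \<alpha>1 (fst p) (fst q)) * cnj (root_coeff G \<alpha>2 (snd p) (fst (snd q))) * root_coeff G \<alpha>3 x (snd (snd q))) *
        (cnj (t False \<alpha>1 (ket (fst (fst q))) u) * cnj (t False \<alpha>2 (ket (fst (fst (snd q)))) v) * d False (ket (fst (snd (snd q)))) (interleave u v)) *
        (cnj (t True \<alpha>1 (ket (snd (fst q))) u') * cnj (t True \<alpha>2 (ket (snd (fst (snd q)))) v') * d True (ket (snd (snd (snd q)))) (interleave u' v')))"
  proof -
    have prod3: "(\<Sum>a\<in>A. f a) * (\<Sum>b\<in>B. g b) * (\<Sum>c\<in>C. h c) =
        (\<Sum>q\<in>A \<times> B \<times> C. f (fst q) * g (fst (snd q)) * h (snd (snd q)))"
      for A B C and f g h :: "_ \<Rightarrow> complex"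
    proof -
      have "sum f A * (sum g B * sum h C) = (\<Sum>a\<in>A. \<Sum>b\<in>B. \<Sum>c\<in>C. f a * (g b * h c))"
        by (simp flip: sum_distrib_left sum_distrib_right)
      then show ?thesis by (simp add: sum.cartesian_product split_def mult.assoc)
    qed
    show ?thesis unfolding prod3 by (simp only: mult_ac)
  qed
  also have "\<dots> = (\<Sum>q\<in>child_pairs G \<alpha>1 \<times> child_pairs G \<alpha>2 \<times> child_pairs G \<alpha>3.
        (cnj (root_coeff G \<alpha>1 (fst p) (fst q)) * cnj (root_coeff G \<alpha>2 (snd p) (fst (snd q))) * root_coeff G \<alpha>3 x (snd (snd q))) *
        (\<Sum>u\<in>W False \<alpha>1. \<Sum>v\<in>W False \<alpha>2. cnj (t False \<alpha>1 (ket (fst (fst q))) u) * cnj (t False \<alpha>2 (ket (fst (fst (snd q)))) v) * d False (ket (fst (snd (snd q)))) (interleave u v)) *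
        (\<Sum>u'\<in>W True \<alpha>1. \<Sum>v'\<in>W True \<alpha>2. cnj (t True \<alpha>1 (ket (snd (fst q))) u') * cnj (t True \<alpha>2 (ket (snd (fst (snd q)))) v') * d True (ket (snd (snd (snd q)))) (interleave u' v')))"
    by (rule sum_separate)
  also have "\<dots> = node_overlap G \<alpha>1 \<alpha>2 \<alpha>3
     (tree_overlap G l (\<lambda>p. \<alpha>1 (False # p)) (\<lambda>p. \<alpha>2 (False # p)) (\<lambda>p. \<alpha>3 (False # p)) (\<lambda>p. ks (False # p)))
     (tree_overlap G r (\<lambda>p. \<alpha>1 (True # p)) (\<lambda>p. \<alpha>2 (True # p)) (\<lambda>p. \<alpha>3 (True # p)) (\<lambda>p. ks (True # p))) x p"
    unfolding node_overlap_def tree_overlap_def t_def d_def W_def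
    by (simp only: sum.cartesian_product split_def fst_conv snd_conv if_True if_False)
  finally show ?thesis .
qed

lemma node_overlap_cong:
  assumes "\<And>y q. q \<in> basis_words G [hw \<alpha>1 [False]] \<times> basis_words G [hw \<alpha>2 [False]] \<Longrightarrow>
      y \<in> basis_words G [hw \<alpha>3 [False]] \<Longrightarrow> X y q = X' y q"
    and "\<And>y q. q \<in> basis_words G [hw \<alpha>1 [True]] \<times> basis_words G [hw \<alpha>2 [True]] \<Longrightarrow>
      y \<in> basis_words G [hw \<alpha>3 [True]] \<Longrightarrow> Y y q = Y' y q"
  shows "node_overlap G \<alpha>1 \<alpha>2 \<alpha>3 X Y x p = node_overlap G \<alpha>1 \<alpha>2 \<alpha>3 X' Y' x p"
  unfolding node_overlap_def
  by (intro sum.cong refl) (auto simp: assms)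

text \<open>Bilinearity, in the form that accepts the expansions of both children in
  couplings.\<close>

lemma node_overlap_sum:
  fixes G :: "('g, 'e::real_normed_vector, 'l, 'w, 'm) recoupling_data_scheme"
    and \<alpha>1 \<alpha>2 \<alpha>3 :: "'l labelling"
  shows "node_overlap G \<alpha>1 \<alpha>2 \<alpha>3 (\<lambda>y q. \<Sum>j\<in>J. a j * X j y q) (\<lambda>y q. \<Sum>k\<in>K. b k * Y k y q) x p =
   (\<Sum>j\<in>J. \<Sum>k\<in>K. a j * b k * node_overlap G \<alpha>1 \<alpha>2 \<alpha>3 (X j) (Y k) x p)"
proof -
  let ?Q = "child_pairs G \<alpha>1 \<times> child_pairs G \<alpha>2 \<times> child_pairs G \<alpha>3"
  define K' where "K' q = cnj (root_coeff G \<alpha>1 (fst p) (fst q)) * cnj (root_coeff G \<alpha>2 (snd p) (fst (snd q))) *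
    root_coeff G \<alpha>3 x (snd (snd q))" for q
  define X' where "X' j q = X j (fst (snd (snd q))) (fst (fst q), fst (fst (snd q)))"
    for j and q :: "('w list \<times> 'w list) \<times> ('w list \<times> 'w list) \<times> 'w list \<times> 'w list"
  define Y' where "Y' k q = Y k (snd (snd (snd q))) (snd (fst q), snd (fst (snd q)))"
    for k and q :: "('w list \<times> 'w list) \<times> ('w list \<times> 'w list) \<times> 'w list \<times> 'w list"
  have flat: "node_overlap G \<alpha>1 \<alpha>2 \<alpha>3 V W x p = (\<Sum>q\<in>?Q. K' q *
      V (fst (snd (snd q))) (fst (fst q), fst (fst (snd q))) * W (snd (snd (snd q))) (snd (fst q), snd (fst (snd q))))"
    for V W by (simp add: node_overlap_def K'_def sum.cartesian_product split_def)
  have "node_overlap G \<alpha>1 \<alpha>2 \<alpha>3 (\<lambda>y q. \<Sum>j\<in>J. a j * X j y q) (\<lambda>y q. \<Sum>k\<in>K. b k * Y k y q) x p =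
      (\<Sum>q\<in>?Q. K' q * (\<Sum>j\<in>J. a j * X' j q) * (\<Sum>k\<in>K. b k * Y' k q))"
    by (simp only: flat X'_def Y'_def)
  also have "\<dots> = (\<Sum>q\<in>?Q. \<Sum>j\<in>J. \<Sum>k\<in>K. a j * b k * (K' q * X' j q * Y' k q))"
    by (simp only: sum_product sum_distrib_left sum_distrib_right mult_ac)
  also have "\<dots> = (\<Sum>j\<in>J. \<Sum>q\<in>?Q. \<Sum>k\<in>K. a j * b k * (K' q * X' j q * Y' k q))"
    by (rule sum.swap)
  also have "\<dots> = (\<Sum>j\<in>J. \<Sum>k\<in>K. \<Sum>q\<in>?Q. a j * b k * (K' q * X' j q * Y' k q))"
    by (intro sum.cong refl sum.swap)
  also have "\<dots> = (\<Sum>j\<in>J. \<Sum>k\<in>K. a j * b k * node_overlap G \<alpha>1 \<alpha>2 \<alpha>3 (X j) (Y k) x p)"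
    by (simp only: flat X'_def Y'_def sum_distrib_left)
  finally show ?thesis .
qed

section \<open>Transposes, leaf counts and the permutation of the leaves\<close>

lemma tensor_mat_transpose:
  "(\<lambda>i j. tensor_mat \<rho> \<sigma> j i) = tensor_mat (\<lambda>i j. \<rho> j i) (\<lambda>i j. \<sigma> j i)"
  by (simp add: fun_eq_iff tensor_mat_def)

lemma basis_words_singleton: "basis_words G [l] = (\<lambda>\<mu>. [\<mu>]) ` weights G l"
  by (auto simp: basis_words_def set_Cons_def)

text \<open>Leaf paths are distinct. This reconciles the cardinality in
  \<open>tree_recoupling\<close> with the lengths of words.\<close>

lemma card_leaves: "card (leaves T) = length (leaf_list T)"
proof -
  have "distinct (leaf_list T)"
    by (induction T) (auto simp: distinct_map)
  then show ?thesis by (simp add: leaves_def distinct_card)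
qed

text \<open>Makes the \<open>inv_into UNIV\<close> inside \<open>permute_factors\<close> a genuine
  left inverse.\<close>

lemma inj_unshuffle: "inj (unshuffle N)"
  by (rule injI) (auto simp: unshuffle_def split: if_splits, presburger+)

lemma nth_interleave:
  "length u = length v \<Longrightarrow> i < 2 * length u \<Longrightarrow>
   interleave u v ! i = (if even i then u ! (i div 2) else v ! (i div 2))"
proof (induction u v arbitrary: i rule: list_induct2)
  case Nil
  then show ?case by simp
next
  case (Cons a u b v)
  show ?case
  proof (cases "i < 2")
    case True
    then show ?thesis by (auto simp: less_2_cases_iff)
  next
    case False
    then obtain i' where "i = Suc (Suc i')" by (metis add_2_eq_Suc le_add_diff_inverse not_less)
    then show ?thesis using Cons by simp
  qed
qed

text \<open>Links the permutation in the coefficient to \<open>interleave\<close>: the permuted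
  vector at the word \<open>u @ v\<close> of the join is the original vector at
  \<open>interleave u v\<close>.\<close>

lemma permute_list_unshuffle:
  assumes "length u = N" "length v = N"
  shows "permute_list (inv_into UNIV (unshuffle N)) (u @ v) = interleave u v"
proof (rule nth_equalityI)
  show "length (permute_list (inv_into UNIV (unshuffle N)) (u @ v)) = length (interleave u v)"
    using assms by (simp add: length_interleave)
  fix i assume "i < length (permute_list (inv_into UNIV (unshuffle N)) (u @ v))"
  then have i: "i < 2 * N" using assms by simp
  \<comment> \<open>The preimage of \<open>i\<close> under \<open>unshuffle N\<close>: even
    positions come from the first word, odd ones from the second, which starts at
    \<open>N\<close>.\<close>
  define i' where "i' = (if even i then i div 2 else i div 2 + N)"
  have "unshuffle N i' = i" using i by (auto simp: i'_def unshuffle_def)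
  then have "inv_into UNIV (unshuffle N) i = i'" by (metis inj_unshuffle inv_f_f)
  then show "permute_list (inv_into UNIV (unshuffle N)) (u @ v) ! i = interleave u v ! i"
    using i assms by (auto simp: permute_list_def nth_append nth_interleave i'_def)
qed

section \<open>Schur's lemma applied to overlaps\<close>

context recoupling_setting
begin

text \<open>Composing \<open>Z\<close> with the adjoint of a coupling \<open>c\<close> gives an
  intertwiner between irreps, which is a scalar if \<open>c\<close> has weight \<open>l\<close> and
  0 otherwise; completeness reassembles \<open>Z\<close>. That \<open>r k\<close> does not depend on
  \<open>x\<close> will make the recoupling coefficient well defined.\<close>

lemma intertwining_matrix_expand:
  assumes l: "l1 \<in> irreps G" "l2 \<in> irreps G" "l \<in> irreps G"
    and Z: "\<And>g. g \<in> carrier G \<Longrightarrow>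
      intertwining_matrix (basis_words G [l]) (basis_words G [l1] \<times> basis_words G [l2])
        (rep_mat G l g) (tensor_mat (rep_mat G l1 g) (rep_mat G l2 g)) Z"
  shows "\<exists>r. (\<forall>k\<in>{1..tensor_multiplicity G l1 l2 l}. \<forall>x\<in>basis_words G [l].
        (\<Sum>p\<in>basis_words G [l1] \<times> basis_words G [l2].
          cnj (coupling_coeff G l1 l2 (l, k) x p) * Z x p) = r k) \<and>
      (\<forall>x\<in>basis_words G [l]. \<forall>p\<in>basis_words G [l1] \<times> basis_words G [l2].
        Z x p = (\<Sum>k=1..tensor_multiplicity G l1 l2 l. r k * coupling_coeff G l1 l2 (l, k) x p))"
proof -
  let ?B = "basis_words G [l]" and ?P = "basis_words G [l1] \<times> basis_words G [l2]"
  define M where "M c x y = (\<Sum>p\<in>?P. Z x p * cnj (coupling_coeff G l1 l2 c y p))" for c x y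
  have "\<exists>r. \<forall>x\<in>?B. \<forall>y\<in>basis_words G [fst c]. M c x y = (if l = fst c \<and> x = y then r else 0)"
    if c: "c \<in> couplings G l1 l2" for c
  proof (rule intertwining_matrix_schur[OF l(3) couplings_irreps[OF c]])
    fix g assume g: "g \<in> carrier G"
    note fc = couplings_irreps[OF c]
    have "intertwining_matrix ?P (basis_words G [fst c])
        (tensor_mat (rep_mat G l1 g) (rep_mat G l2 g)) (rep_mat G (fst c) g)
        (\<lambda>p y. cnj (coupling_coeff G l1 l2 c y p))"
      by (rule intertwining_matrix_adjoint[OF coupling_coeff_intertwining[OF l(1,2) c g]])
         (use l fc g in \<open>simp_all add: irrep_basis rep_mat_rows rep_mat_columns
            orthonormal_columns_tensor\<close>)
    from intertwining_matrix_comp[OF Z[OF g] this]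
    show "intertwining_matrix ?B (basis_words G [fst c]) (rep_mat G l g) (rep_mat G (fst c) g) (M c)"
      unfolding M_def .
  qed
  then obtain r where r: "M c x y = (if l = fst c \<and> x = y then r c else 0)"
    if "c \<in> couplings G l1 l2" "x \<in> ?B" "y \<in> basis_words G [fst c]" for c x y
    by metis
  let ?m = "tensor_multiplicity G l1 l2 l"
  have mem: "(l, k) \<in> couplings G l1 l2" if "k \<in> {1..?m}" for k
    using that l(3) by (auto simp: couplings_def)
  have "(\<Sum>p\<in>?P. cnj (coupling_coeff G l1 l2 (l, k) x p) * Z x p) = r (l, k)"
    if "k \<in> {1..?m}" "x \<in> ?B" for k x
    using r[OF mem[OF that(1)] that(2), of x] that(2) by (simp add: M_def mult.commute)
  moreover have "Z x p = (\<Sum>k=1..?m. r (l, k) * coupling_coeff G l1 l2 (l, k) x p)"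
    if x: "x \<in> ?B" and p: "p \<in> ?P" for x p
  proof -
    have "Z x p = (\<Sum>c\<in>couplings G l1 l2. \<Sum>y\<in>basis_words G [fst c]. M c x y * coupling_coeff G l1 l2 c y p)"
      using coupling_coeff_complete[OF l(1,2) p, of "Z x"] by (simp add: M_def mult.commute)
    also have "\<dots> = (\<Sum>c\<in>couplings G l1 l2. if fst c = l then r c * coupling_coeff G l1 l2 c x p else 0)"
    proof (rule sum.cong[OF refl])
      fix c assume c: "c \<in> couplings G l1 l2"
      have "(\<Sum>y\<in>basis_words G [fst c]. M c x y * coupling_coeff G l1 l2 c y p) =
          (\<Sum>y\<in>basis_words G [fst c]. if x = y then (if fst c = l then r c * coupling_coeff G l1 l2 c x p else 0) else 0)"
        by (intro sum.cong refl) (auto simp: r[OF c x])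
      then show "(\<Sum>y\<in>basis_words G [fst c]. M c x y * coupling_coeff G l1 l2 c y p) =
          (if fst c = l then r c * coupling_coeff G l1 l2 c x p else 0)"
        using x irrep_basis(1)[OF couplings_irreps[OF c]] by auto
    qed
    \<comment> \<open>The couplings of weight \<open>l\<close> are its copies, numbered by
      \<open>1..?m\<close>.\<close>
    also have "\<dots> = (\<Sum>c\<in>Pair l ` {1..?m}. r c * coupling_coeff G l1 l2 c x p)"
      using finite_couplings[OF l(1,2)] l(3)
      by (intro sum.mono_neutral_cong_right) (auto simp: couplings_def)
    also have "\<dots> = (\<Sum>k=1..?m. r (l, k) * coupling_coeff G l1 l2 (l, k) x p)"
      by (subst sum.reindex) (auto simp: inj_on_def)
    finally show ?thesis .
  qed
  ultimately show ?thesis by (intro exI[of _ "\<lambda>k. r (l, k)"]) blast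
qed

text \<open>The operator is a composition of equivariant ones: the root coupling of \<alpha>3, then
  \<open>X\<close> tensor \<open>Y\<close>, then the interchange of the middle factors, then the
  adjoint of the root couplings of \<alpha>1 and \<alpha>2.\<close>

lemma node_overlap_intertwining:
  assumes irr: "hw \<alpha>1 [False] \<in> irreps G" "hw \<alpha>1 [True] \<in> irreps G"
      "hw \<alpha>2 [False] \<in> irreps G" "hw \<alpha>2 [True] \<in> irreps G"
      "hw \<alpha>3 [False] \<in> irreps G" "hw \<alpha>3 [True] \<in> irreps G"
    and c: "\<alpha>1 [] \<in> couplings G (hw \<alpha>1 [False]) (hw \<alpha>1 [True])"
      "\<alpha>2 [] \<in> couplings G (hw \<alpha>2 [False]) (hw \<alpha>2 [True])"
      "\<alpha>3 [] \<in> couplings G (hw \<alpha>3 [False]) (hw \<alpha>3 [True])"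
    and g: "g \<in> carrier G"
    and X: "intertwining_matrix (basis_words G [hw \<alpha>3 [False]])
        (basis_words G [hw \<alpha>1 [False]] \<times> basis_words G [hw \<alpha>2 [False]])
        (rep_mat G (hw \<alpha>3 [False]) g)
        (tensor_mat (rep_mat G (hw \<alpha>1 [False]) g) (rep_mat G (hw \<alpha>2 [False]) g)) X"
    and Y: "intertwining_matrix (basis_words G [hw \<alpha>3 [True]])
        (basis_words G [hw \<alpha>1 [True]] \<times> basis_words G [hw \<alpha>2 [True]])
        (rep_mat G (hw \<alpha>3 [True]) g)
        (tensor_mat (rep_mat G (hw \<alpha>1 [True]) g) (rep_mat G (hw \<alpha>2 [True]) g)) Y"
  shows "intertwining_matrix (basis_words G [hw \<alpha>3 []])
      (basis_words G [hw \<alpha>1 []] \<times> basis_words G [hw \<alpha>2 []])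
      (rep_mat G (hw \<alpha>3 []) g) (tensor_mat (rep_mat G (hw \<alpha>1 []) g) (rep_mat G (hw \<alpha>2 []) g))
      (node_overlap G \<alpha>1 \<alpha>2 \<alpha>3 X Y)"
proof -
  define D where "D \<alpha> = tensor_mat (rep_mat G (hw \<alpha> [False]) g) (rep_mat G (hw \<alpha> [True]) g)" for \<alpha>
  \<comment> \<open>The interchange of the middle factors, an involution: the children of \<alpha>1
    and of \<alpha>2 are regrouped into left and right pairs.\<close>
  define h where "h q = ((fst (fst q), fst (snd q)), (snd (fst q), snd (snd q)))"
    for q :: "('w list \<times> 'w list) \<times> 'w list \<times> 'w list"
  let ?Q = "child_pairs G \<alpha>1 \<times> child_pairs G \<alpha>2"
  let ?P = "basis_words G [hw \<alpha>1 []] \<times> basis_words G [hw \<alpha>2 []]"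
  have h: "bij_betw h ?Q
      ((basis_words G [hw \<alpha>1 [False]] \<times> basis_words G [hw \<alpha>2 [False]]) \<times>
       (basis_words G [hw \<alpha>1 [True]] \<times> basis_words G [hw \<alpha>2 [True]]))"
    by (rule bij_betw_byWitness[where f'=h]) (auto simp: h_def)
  have V: "intertwining_matrix (basis_words G [hw \<alpha>3 []]) ?Q (rep_mat G (hw \<alpha>3 []) g)
      (tensor_mat (D \<alpha>1) (D \<alpha>2)) (\<lambda>x q. \<Sum>p3\<in>child_pairs G \<alpha>3. root_coeff G \<alpha>3 x p3 * tensor_mat X Y p3 (h q))"
  proof -
    have "tensor_mat (D \<alpha>1) (D \<alpha>2) = (\<lambda>k k'. tensor_mat
        (tensor_mat (rep_mat G (hw \<alpha>1 [False]) g) (rep_mat G (hw \<alpha>2 [False]) g))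
        (tensor_mat (rep_mat G (hw \<alpha>1 [True]) g) (rep_mat G (hw \<alpha>2 [True]) g)) (h k) (h k'))"
      by (simp add: fun_eq_iff tensor_mat_def h_def D_def mult_ac)
    then show ?thesis
      using intertwining_matrix_reindex[OF intertwining_matrix_comp[OF
            coupling_coeff_intertwining[OF irr(5,6) c(3) g] intertwining_matrix_tensor[OF X Y]] h]
      by simp
  qed
  have U: "intertwining_matrix ?Q ?P (tensor_mat (D \<alpha>1) (D \<alpha>2))
      (tensor_mat (rep_mat G (hw \<alpha>1 []) g) (rep_mat G (hw \<alpha>2 []) g))
      (\<lambda>q p. cnj (tensor_mat (root_coeff G \<alpha>1) (root_coeff G \<alpha>2) p q))"
  proof (rule intertwining_matrix_adjoint)
    show "intertwining_matrix ?P ?Q (tensor_mat (rep_mat G (hw \<alpha>1 []) g) (rep_mat G (hw \<alpha>2 []) g))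
       (tensor_mat (D \<alpha>1) (D \<alpha>2)) (tensor_mat (root_coeff G \<alpha>1) (root_coeff G \<alpha>2))"
      unfolding D_def
      by (intro intertwining_matrix_tensor coupling_coeff_intertwining irr c g)
    show "finite ?P" "finite ?Q" by (auto intro!: irrep_basis(1) irr couplings_irreps[OF c(1)] couplings_irreps[OF c(2)])
    show "orthonormal_columns ?P
       (\<lambda>i j. tensor_mat (rep_mat G (hw \<alpha>1 []) g) (rep_mat G (hw \<alpha>2 []) g) j i)"
      unfolding tensor_mat_transpose
      by (intro orthonormal_columns_tensor rep_mat_rows couplings_irreps[OF c(1)] couplings_irreps[OF c(2)] g)
    show "orthonormal_columns ?Q (tensor_mat (D \<alpha>1) (D \<alpha>2))"
      unfolding D_def by (intro orthonormal_columns_tensor rep_mat_columns irr g)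
  qed
  have "(\<lambda>x p. \<Sum>q\<in>?Q. (\<Sum>p3\<in>child_pairs G \<alpha>3. root_coeff G \<alpha>3 x p3 * tensor_mat X Y p3 (h q)) *
      cnj (tensor_mat (root_coeff G \<alpha>1) (root_coeff G \<alpha>2) p q)) = node_overlap G \<alpha>1 \<alpha>2 \<alpha>3 X Y"
    unfolding node_overlap_def h_def tensor_mat_def
    by (simp add: fun_eq_iff sum.cartesian_product' sum_distrib_left sum_distrib_right mult_ac)
  with intertwining_matrix_comp[OF V U] show ?thesis by simp
qed

text \<open>The overlap contains everything except the coupling at the new root of the join;
  contracting with that coupling restores the inner product in \<open>recoupling\<close>.\<close>

lemma recoupling_join_dup:
  assumes irr: "hw \<alpha>3 [] \<in> irreps G"
    and r: "\<And>x. x \<in> basis_words G [hw \<alpha>3 []] \<Longrightarrow>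
      (\<Sum>p\<in>basis_words G [hw \<alpha>1 []] \<times> basis_words G [hw \<alpha>2 []].
        cnj (coupling_coeff G (hw \<alpha>1 []) (hw \<alpha>2 []) (hw \<alpha>3 [], k) x p) *
        tree_overlap G T \<alpha>1 \<alpha>2 \<alpha>3 ks x p) = r"
  shows "recoupling G (unshuffle (card (leaves T))) (Node T T) (join_label \<alpha>1 \<alpha>2 (hw \<alpha>3 [], k))
    (leaf_dup T) (dup_label T \<alpha>1 \<alpha>2 \<alpha>3 ks) = r"
proof -
  let ?j = "join_label \<alpha>1 \<alpha>2 (hw \<alpha>3 [], k)" and ?d = "dup_label T \<alpha>1 \<alpha>2 \<alpha>3 ks"
  let ?P = "basis_words G [hw \<alpha>1 []] \<times> basis_words G [hw \<alpha>2 []]"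
  let ?W1 = "basis_words G (leaf_weights T \<alpha>1)" and ?W2 = "basis_words G (leaf_weights T \<alpha>2)"
  let ?cc = "coupling_coeff G (hw \<alpha>1 []) (hw \<alpha>2 []) (hw \<alpha>3 [], k)"
  have j: "?j [] = (hw \<alpha>3 [], k)" "?j (False # p) = \<alpha>1 p" "?j (True # p) = \<alpha>2 p" for p
    by (simp_all add: join_label_def)
  have "cinner (basis_words G (leaf_weights (Node T T) ?j)) (tree_ket G (Node T T) ?j \<mu>)
      (permute_factors (unshuffle (card (leaves T))) (tree_ket G (leaf_dup T) ?d \<mu>)) = r"
    if mu: "\<mu> \<in> weights G (hw \<alpha>3 [])" for \<mu>
  proof -
    have "cinner (basis_words G (leaf_weights (Node T T) ?j)) (tree_ket G (Node T T) ?j \<mu>)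
        (permute_factors (unshuffle (card (leaves T))) (tree_ket G (leaf_dup T) ?d \<mu>)) =
        (\<Sum>u\<in>?W1. \<Sum>v\<in>?W2. cnj (tree_inj G (Node T T) ?j (ket [\<mu>]) (u @ v)) *
          tree_inj G (leaf_dup T) ?d (ket [\<mu>])
            (permute_list (inv_into UNIV (unshuffle (length (leaf_list T)))) (u @ v)))"
      by (simp only: cinner_def leaf_weights_Node sum_basis_words_append j tree_ket_def
          permute_factors_def card_leaves)
    also have "\<dots> = (\<Sum>u\<in>?W1. \<Sum>v\<in>?W2. \<Sum>p\<in>?P. cnj (?cc [\<mu>] p) *
        (cnj (tree_inj G T \<alpha>1 (ket (fst p)) u) * cnj (tree_inj G T \<alpha>2 (ket (snd p)) v) *
         tree_inj G (leaf_dup T) ?d (ket [\<mu>]) (interleave u v)))"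
    proof (intro sum.cong refl)
      fix u v assume "u \<in> ?W1" "v \<in> ?W2"
      then have len: "length u = length (leaf_list T)" "length v = length (leaf_list T)"
        by (auto dest: length_basis_words)
      show "cnj (tree_inj G (Node T T) ?j (ket [\<mu>]) (u @ v)) * tree_inj G (leaf_dup T) ?d (ket [\<mu>])
            (permute_list (inv_into UNIV (unshuffle (length (leaf_list T)))) (u @ v)) =
          (\<Sum>p\<in>?P. cnj (?cc [\<mu>] p) *
            (cnj (tree_inj G T \<alpha>1 (ket (fst p)) u) * cnj (tree_inj G T \<alpha>2 (ket (snd p)) v) *
             tree_inj G (leaf_dup T) ?d (ket [\<mu>]) (interleave u v)))"
        unfolding tree_inj_Node_root_coeff[OF len(1)] permute_list_unshuffle[OF len]
        by (simp add: j sum_distrib_left sum_distrib_right mult_ac)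
    qed
    also have "\<dots> = (\<Sum>u\<in>?W1. \<Sum>p\<in>?P. \<Sum>v\<in>?W2. cnj (?cc [\<mu>] p) *
        (cnj (tree_inj G T \<alpha>1 (ket (fst p)) u) * cnj (tree_inj G T \<alpha>2 (ket (snd p)) v) *
         tree_inj G (leaf_dup T) ?d (ket [\<mu>]) (interleave u v)))"
      by (intro sum.cong refl sum.swap)
    also have "\<dots> = (\<Sum>p\<in>?P. \<Sum>u\<in>?W1. \<Sum>v\<in>?W2. cnj (?cc [\<mu>] p) *
        (cnj (tree_inj G T \<alpha>1 (ket (fst p)) u) * cnj (tree_inj G T \<alpha>2 (ket (snd p)) v) *
         tree_inj G (leaf_dup T) ?d (ket [\<mu>]) (interleave u v)))"
      by (rule sum.swap)
    also have "\<dots> = (\<Sum>p\<in>?P. cnj (?cc [\<mu>] p) * tree_overlap G T \<alpha>1 \<alpha>2 \<alpha>3 ks [\<mu>] p)"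
      by (simp only: tree_overlap_def sum_distrib_left)
    also have "\<dots> = r" using mu by (intro r) (simp add: basis_words_singleton)
    finally show ?thesis .
  qed
  \<comment> \<open>Needed for uniqueness in the definite description: with no weight at all, every
    \<open>c\<close> would qualify.\<close>
  moreover have "weights G (hw \<alpha>3 []) \<noteq> {}"
    using irrep_basis(2)[OF irr] by (simp add: basis_words_singleton)
  ultimately show ?thesis
    unfolding recoupling_def dup_label_root by (intro the_equality) auto
qed

end

section \<open>Sums over counters\<close>

text \<open>The sum over counters in recursive form, with ranges \<open>E\<close> and node factors
  \<open>f\<close> kept abstract; \<open>k\<close> is the counter at the root. Leaf counters are
  summed too, over ranges that will be singletons.\<close>

primrec tree_coeff ::
  "btree \<Rightarrow> (vertex \<Rightarrow> nat set) \<Rightarrow> (vertex \<Rightarrow> nat \<Rightarrow> nat \<Rightarrow> nat \<Rightarrow> complex) \<Rightarrow> nat \<Rightarrow> complex" where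
  "tree_coeff Leaf E f k = 1"
| "tree_coeff (Node l r) E f k = (\<Sum>k'\<in>E [False]. \<Sum>k''\<in>E [True].
     tree_coeff l (\<lambda>p. E (False # p)) (\<lambda>p. f (False # p)) k' *
     tree_coeff r (\<lambda>p. E (True # p)) (\<lambda>p. f (True # p)) k'' * f [] k' k'' k)"

abbreviation vertices :: "btree \<Rightarrow> vertex set" where
  "vertices T \<equiv> nodes T \<union> leaves T"

lemma vertices_Node: "vertices (Node l r) = insert [] (Cons False ` vertices l \<union> Cons True ` vertices r)"
  by auto

lemma finite_nodes: "finite (nodes T)"
  by (induction T) auto

text \<open>Counters on the non-root vertices of a tree amount to one counter for each child of the
  root together with counters on the non-root vertices of each subtree. The update at
  \<open>[]\<close> supplies the root counter to the product.\<close>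

lemma tree_coeff_eq_sum:
  "tree_coeff T E f k = (\<Sum>\<kappa>\<in>Pi\<^sub>E (vertices T - {[]}) E. \<Prod>x\<in>nodes T.
     f x ((\<kappa>([] := k)) (lchild x)) ((\<kappa>([] := k)) (rchild x)) ((\<kappa>([] := k)) x))"
proof (induction T arbitrary: E f k)
  case Leaf
  then show ?case by simp
next
  case (Node l r)
  define F where "F b p = f (b # p)" for b p
  define E' where "E' b p = E (b # p)" for b p
  define P where "P T f \<kappa> k = (\<Prod>x\<in>nodes T.
     f x ((\<kappa>([] := k)) (lchild x)) ((\<kappa>([] := k)) (rchild x)) ((\<kappa>([] := k)) x))"
    for T and f :: "vertex \<Rightarrow> nat \<Rightarrow> nat \<Rightarrow> nat \<Rightarrow> complex" and \<kappa> k
  define PE where "PE b = Pi\<^sub>E (vertices (if b then r else l) - {[]}) (E' b)" for b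
  define unglue where "unglue \<kappa> = ((\<kappa> [False], \<lambda>y\<in>vertices l - {[]}. \<kappa> (False # y)),
      (\<kappa> [True], \<lambda>y\<in>vertices r - {[]}. \<kappa> (True # y)))" for \<kappa> :: "vertex \<Rightarrow> nat"
  \<comment> \<open>The inverse of \<open>unglue\<close>: the counter of a child goes to the root of
    its subtree. The value at \<open>[]\<close> is \<open>undefined\<close>, as membership in
    \<open>Pi\<^sub>E\<close> over non-root vertices demands.\<close>
  define glue where "glue s z = (case z of [] \<Rightarrow> undefined | b # y \<Rightarrow>
      if b then ((snd (snd s))([] := fst (snd s))) y else ((snd (fst s))([] := fst (fst s))) y)"
    for s :: "(nat \<times> (vertex \<Rightarrow> nat)) \<times> nat \<times> (vertex \<Rightarrow> nat)" and z
  let ?S = "(E [False] \<times> PE False) \<times> (E [True] \<times> PE True)"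
  have rootl: "[] \<in> vertices l" and rootr: "[] \<in> vertices r" using root_vertex by auto
  have "tree_coeff (Node l r) E f k = (\<Sum>k'\<in>E [False]. \<Sum>k''\<in>E [True].
      (\<Sum>\<kappa>\<in>PE False. P l (F False) \<kappa> k') * (\<Sum>\<kappa>\<in>PE True. P r (F True) \<kappa> k'') * f [] k' k'' k)"
    by (simp add: Node.IH P_def PE_def E'_def[abs_def] F_def)
  also have "\<dots> = (\<Sum>k'\<in>E [False]. \<Sum>k''\<in>E [True]. \<Sum>\<kappa>\<in>PE False. \<Sum>\<kappa>'\<in>PE True.
      P l (F False) \<kappa> k' * P r (F True) \<kappa>' k'' * f [] k' k'' k)"
    by (simp only: sum_product) (simp only: sum_distrib_right)
  also have "\<dots> = (\<Sum>k'\<in>E [False]. \<Sum>\<kappa>\<in>PE False. \<Sum>k''\<in>E [True]. \<Sum>\<kappa>'\<in>PE True.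
      P l (F False) \<kappa> k' * P r (F True) \<kappa>' k'' * f [] k' k'' k)"
    by (intro sum.cong refl sum.swap)
  also have "\<dots> = (\<Sum>s\<in>?S. P l (F False) (snd (fst s)) (fst (fst s)) *
      P r (F True) (snd (snd s)) (fst (snd s)) * f [] (fst (fst s)) (fst (snd s)) k)"
    by (simp only: sum.cartesian_product' fst_conv snd_conv)
  also have "\<dots> = (\<Sum>\<kappa>\<in>Pi\<^sub>E (vertices (Node l r) - {[]}) E. P (Node l r) f \<kappa> k)"
  proof (rule sum.reindex_bij_witness[where j=glue and i=unglue])
    fix s assume s: "s \<in> ?S"
    obtain k' \<kappa> k'' \<kappa>' where seq: "s = ((k', \<kappa>), (k'', \<kappa>'))" by (metis prod.collapse)
    have ks: "k' \<in> E [False]" "k'' \<in> E [True]" and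
      k1: "\<kappa> \<in> Pi\<^sub>E (vertices l - {[]}) (E' False)" and k2: "\<kappa>' \<in> Pi\<^sub>E (vertices r - {[]}) (E' True)"
      using s unfolding seq PE_def mem_Times_iff fst_conv snd_conv if_True if_False by blast+
    have glue: "glue s (False # y) = (if y = [] then k' else \<kappa> y)"
      "glue s (True # y) = (if y = [] then k'' else \<kappa>' y)" for y
      by (simp_all add: glue_def seq)
    have "(\<lambda>y\<in>vertices l - {[]}. glue s (False # y)) = restrict \<kappa> (vertices l - {[]})"
      by (rule restrict_ext) (simp add: glue)
    also have "\<dots> = \<kappa>" using k1 by (rule PiE_restrict)
    finally have r1: "(\<lambda>y\<in>vertices l - {[]}. glue s (False # y)) = \<kappa>" .
    have "(\<lambda>y\<in>vertices r - {[]}. glue s (True # y)) = restrict \<kappa>' (vertices r - {[]})"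
      by (rule restrict_ext) (simp add: glue)
    also have "\<dots> = \<kappa>'" using k2 by (rule PiE_restrict)
    finally have r2: "(\<lambda>y\<in>vertices r - {[]}. glue s (True # y)) = \<kappa>'" .
    have "unglue (glue s) = ((k', \<kappa>), (k'', \<kappa>'))"
      unfolding unglue_def r1 r2 by (simp add: glue)
    then show "unglue (glue s) = s" by (simp only: seq)
    show "glue s \<in> Pi\<^sub>E (vertices (Node l r) - {[]}) E"
    proof (rule PiE_I)
      fix z assume "z \<in> vertices (Node l r) - {[]}"
      then obtain b y where z: "z = b # y" "y \<in> vertices (if b then r else l)"
        using that[of False] that[of True] unfolding vertices_Node if_True if_False by blast
      show "glue s z \<in> E z"
        using z ks PiE_mem[OF k1, of y] PiE_mem[OF k2, of y]
        by (cases b; cases "y = []") (simp_all add: glue E'_def)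
    next
      fix z assume z: "z \<notin> vertices (Node l r) - {[]}"
      show "glue s z = undefined"
      proof (cases z)
        case Nil
        then show ?thesis by (simp add: glue_def)
      next
        case (Cons b y)
        then have "y \<notin> vertices (if b then r else l)" using z by (cases b) auto
        moreover have "y \<noteq> []" using calculation rootl rootr by (cases b) auto
        ultimately show ?thesis
          using PiE_arb[OF k1, of y] PiE_arb[OF k2, of y] Cons
          by (cases b) (simp_all add: glue)
      qed
    qed
    have inj: "inj_on (Cons b) A" for b :: bool and A by (simp add: inj_on_def)
    let ?h = "\<lambda>x. f x (((glue s)([] := k)) (lchild x)) (((glue s)([] := k)) (rchild x)) (((glue s)([] := k)) x)"
    have "P (Node l r) f (glue s) k = ?h [] * prod ?h (Cons False ` nodes l \<union> Cons True ` nodes r)"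
      unfolding P_def nodes.simps by (rule prod.insert) (auto simp: finite_nodes)
    also have "prod ?h (Cons False ` nodes l \<union> Cons True ` nodes r) =
        prod ?h (Cons False ` nodes l) * prod ?h (Cons True ` nodes r)"
      by (rule prod.union_disjoint) (auto simp: finite_nodes)
    also have "prod ?h (Cons False ` nodes l) = P l (F False) \<kappa> k'"
      by (simp add: prod.reindex[OF inj] P_def F_def glue fun_upd_def)
    also have "prod ?h (Cons True ` nodes r) = P r (F True) \<kappa>' k''"
      by (simp add: prod.reindex[OF inj] P_def F_def glue fun_upd_def)
    finally have "P (Node l r) f (glue s) k = f [] k' k'' k * (P l (F False) \<kappa> k' * P r (F True) \<kappa>' k'')"
      by (simp add: glue)
    then show "P (Node l r) f (glue s) k = P l (F False) (snd (fst s)) (fst (fst s)) *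
        P r (F True) (snd (snd s)) (fst (snd s)) * f [] (fst (fst s)) (fst (snd s)) k"
      by (simp add: seq mult_ac)
  next
    fix \<kappa> assume k: "\<kappa> \<in> Pi\<^sub>E (vertices (Node l r) - {[]}) E"
    have mem: "\<kappa> (b # y) \<in> E (b # y)" if "y \<in> vertices (if b then r else l)" for b y
      using that by (intro PiE_mem[OF k]) (auto split: if_splits)
    show "unglue \<kappa> \<in> ?S"
      using mem[of "[]" False] mem[of "[]" True] mem[of _ False] mem[of _ True] rootl rootr
      by (auto simp: unglue_def PE_def E'_def)
    show "glue (unglue \<kappa>) = \<kappa>"
    proof
      fix z show "glue (unglue \<kappa>) z = \<kappa> z"
      proof (cases z)
        case Nil
        then show ?thesis using PiE_arb[OF k, of "[]"] by (simp add: glue_def)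
      next
        case (Cons b y)
        have "\<kappa> (b # y) = undefined" if "y \<notin> vertices (if b then r else l)"
          using that by (intro PiE_arb[OF k]) (auto split: if_splits)
        then show ?thesis using Cons by (cases b) (auto simp: glue_def unglue_def)
      qed
    qed
  qed
  finally show ?case unfolding P_def .
qed

text \<open>Singleton ranges fix the values at the leaves, so restriction to the internal nodes is a
  bijection, and \<open>counter\<close> puts back what it forgets.\<close>

lemma sum_PiE_counter:
  assumes "T \<noteq> Leaf"
  shows "(\<Sum>\<kappa>\<in>Pi\<^sub>E (vertices T - {[]}) (\<lambda>y. if y \<in> leaves T then {ks y} else E y). h (\<kappa>([] := k))) =
    (\<Sum>\<kappa>\<in>Pi\<^sub>E (internal_nodes T) E. h (counter T k ks \<kappa>))"
proof -
  have root: "[] \<notin> leaves T" using assms by (cases T) auto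
  have V: "vertices T - {[]} = internal_nodes T \<union> leaves T"
    using root by (auto simp: internal_nodes_def)
  have disj: "y \<notin> leaves T" if "y \<in> internal_nodes T" for y
    using that nodes_Int_leaves[of T] by (auto simp: internal_nodes_def)
  show ?thesis
  proof (rule sum.reindex_bij_witness[where i="\<lambda>\<kappa> y. if y \<in> leaves T then ks y else \<kappa> y"
        and j="\<lambda>\<kappa>. restrict \<kappa> (internal_nodes T)"])
    fix \<kappa> assume k: "\<kappa> \<in> Pi\<^sub>E (vertices T - {[]}) (\<lambda>y. if y \<in> leaves T then {ks y} else E y)"
    have leaf: "\<kappa> y = ks y" if "y \<in> leaves T" for y
      using PiE_mem[OF k, of y] that V by auto
    have arb: "\<kappa> y = undefined" if "y \<notin> leaves T" "y \<notin> internal_nodes T" for y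
      using PiE_arb[OF k, of y] that V by auto
    show "(\<lambda>y. if y \<in> leaves T then ks y else restrict \<kappa> (internal_nodes T) y) = \<kappa>"
      using leaf arb by (auto simp: fun_eq_iff restrict_def)
    show "restrict \<kappa> (internal_nodes T) \<in> Pi\<^sub>E (internal_nodes T) E"
      using PiE_mem[OF k] disj V by (fastforce simp: restrict_PiE_iff)
    have "counter T k ks (restrict \<kappa> (internal_nodes T)) = \<kappa>([] := k)"
      using leaf arb by (auto simp: fun_eq_iff counter_def restrict_def)
    then show "h (counter T k ks (restrict \<kappa> (internal_nodes T))) = h (\<kappa>([] := k))" by simp
  next
    fix \<kappa> assume k: "\<kappa> \<in> Pi\<^sub>E (internal_nodes T) E"
    show "(\<lambda>y\<in>internal_nodes T. if y \<in> leaves T then ks y else \<kappa> y) = \<kappa>"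
      using PiE_arb[OF k] disj by (auto simp: fun_eq_iff restrict_def)
    show "(\<lambda>y. if y \<in> leaves T then ks y else \<kappa> y) \<in>
        Pi\<^sub>E (vertices T - {[]}) (\<lambda>y. if y \<in> leaves T then {ks y} else E y)"
      unfolding V using PiE_mem[OF k] PiE_arb[OF k] by (intro PiE_I) auto
  qed
qed

section \<open>The product formula\<close>

text \<open>A prescribed leaf counter is treated as a variable with a single value, so that leaves
  and internal nodes fit the same recursion.\<close>

definition counter_range ::
  "('g, 'e::real_normed_vector, 'l, 'w, 'm) recoupling_data_scheme \<Rightarrow> btree \<Rightarrow>
   'l labelling \<Rightarrow> 'l labelling \<Rightarrow> 'l labelling \<Rightarrow> (vertex \<Rightarrow> nat) \<Rightarrow> vertex \<Rightarrow> nat set" where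
  "counter_range G T \<alpha>1 \<alpha>2 \<alpha>3 ks y =
     (if y \<in> leaves T then {ks y} else {1..tensor_multiplicity G (hw \<alpha>1 y) (hw \<alpha>2 y) (hw \<alpha>3 y)})"

definition nine_lambda_at ::
  "('g, 'e::real_normed_vector, 'l, 'w, 'm) recoupling_data_scheme \<Rightarrow>
   'l labelling \<Rightarrow> 'l labelling \<Rightarrow> 'l labelling \<Rightarrow> vertex \<Rightarrow> nat \<Rightarrow> nat \<Rightarrow> nat \<Rightarrow> complex" where
  "nine_lambda_at G \<alpha>1 \<alpha>2 \<alpha>3 x k' k'' k =
     nine_lambda G
       (hw \<alpha>1 (lchild x), hw \<alpha>1 (rchild x), hw \<alpha>1 x, mc \<alpha>1 x)
       (hw \<alpha>2 (lchild x), hw \<alpha>2 (rchild x), hw \<alpha>2 x, mc \<alpha>2 x)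
       (hw \<alpha>3 (lchild x), hw \<alpha>3 (rchild x), hw \<alpha>3 x, mc \<alpha>3 x) (k', k'', k)"

section \<open>Passage to subtrees and vanishing of the symbols\<close>

lemma counter_range_child:
  "counter_range G (Node l r) \<alpha>1 \<alpha>2 \<alpha>3 ks (b # y) =
   counter_range G (if b then r else l) (\<lambda>p. \<alpha>1 (b # p)) (\<lambda>p. \<alpha>2 (b # p)) (\<lambda>p. \<alpha>3 (b # p))
     (\<lambda>p. ks (b # p)) y"
  by (auto simp: counter_range_def)

lemma nine_lambda_at_child:
  "nine_lambda_at G \<alpha>1 \<alpha>2 \<alpha>3 (b # x) =
   nine_lambda_at G (\<lambda>p. \<alpha>1 (b # p)) (\<lambda>p. \<alpha>2 (b # p)) (\<lambda>p. \<alpha>3 (b # p)) x"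
  by (simp add: nine_lambda_at_def fun_eq_iff)

lemma is_labelling_child:
  "is_labelling G (Node l r) \<alpha> \<Longrightarrow> is_labelling G (if b then r else l) (\<lambda>p. \<alpha> (b # p))"
  by (auto simp: is_labelling_def ball_Un)

lemma is_labelling_root: "is_labelling G (Node l r) \<alpha> \<Longrightarrow> \<alpha> [] \<in> couplings G (hw \<alpha> [False]) (hw \<alpha> [True])"
  by (auto simp: is_labelling_def)

lemma is_labelling_root_irreps: "is_labelling G T \<alpha> \<Longrightarrow> hw \<alpha> [] \<in> irreps G"
  by (cases T) (auto simp: is_labelling_def dest: couplings_irreps)

lemma is_labelling_child_irreps: "is_labelling G (Node l r) \<alpha> \<Longrightarrow> hw \<alpha> [b] \<in> irreps G"
  using is_labelling_root_irreps[OF is_labelling_child] by blast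

text \<open>The symbol inherits the convention that inadmissible coefficients are 0. Read backwards,
  nonzero symbols at all nodes will force admissibility of the whole triple.\<close>

lemma nine_lambda_at_nonzero:
  assumes "nine_lambda_at G \<alpha>1 \<alpha>2 \<alpha>3 x k' k'' k \<noteq> 0"
  shows "(hw \<alpha>3 (lchild x), k') \<in> couplings G (hw \<alpha>1 (lchild x)) (hw \<alpha>2 (lchild x))"
    "(hw \<alpha>3 (rchild x), k'') \<in> couplings G (hw \<alpha>1 (rchild x)) (hw \<alpha>2 (rchild x))"
    "(hw \<alpha>3 x, k) \<in> couplings G (hw \<alpha>1 x) (hw \<alpha>2 x)"
  using assms unfolding nine_lambda_at_def nine_lambda.simps
  by (auto simp: tree_recoupling_def admissible_triple_def cherry_label_def split: if_splits)

lemma leaf_parent: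
  "y \<in> leaves T \<Longrightarrow> y \<noteq> [] \<Longrightarrow> \<exists>x\<in>nodes T. y = lchild x \<or> y = rchild x"
proof (induction T arbitrary: y)
  case Leaf
  then show ?case by simp
next
  case (Node l r)
  then have "y \<in> Cons False ` leaves l \<or> y \<in> Cons True ` leaves r" by simp
  then obtain b y' where y: "y = b # y'" "y' \<in> leaves (if b then r else l)"
    using that[of False] that[of True] by auto
  show ?case
  proof (cases "y' = []")
    case True
    then show ?thesis using y by (cases b) auto
  next
    case False
    then have "\<exists>x\<in>nodes (if b then r else l). y' = lchild x \<or> y' = rchild x"
      using Node.IH y by (cases b) auto
    then obtain x where x: "x \<in> nodes (if b then r else l)" "y' = lchild x \<or> y' = rchild x" by blast
    then have "b # x \<in> nodes (Node l r)" "y = lchild (b # x) \<or> y = rchild (b # x)"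
      using y by (cases b; auto)+
    then show ?thesis by blast
  qed
qed

section \<open>Overlaps expanded in couplings with \<open>9\<lambda>\<close> symbols as
  coefficients\<close>

context recoupling_setting
begin

text \<open>With single couplings at the children, the node is the overlap of a cherry, so the
  scalars supplied by Schur's lemma are recoupling coefficients of a cherry.\<close>

lemma node_overlap_expand:
  assumes T: "is_labelling G (Node l r) \<alpha>1" "is_labelling G (Node l r) \<alpha>2" "is_labelling G (Node l r) \<alpha>3"
    and k': "(hw \<alpha>3 [False], k') \<in> couplings G (hw \<alpha>1 [False]) (hw \<alpha>2 [False])"
    and k'': "(hw \<alpha>3 [True], k'') \<in> couplings G (hw \<alpha>1 [True]) (hw \<alpha>2 [True])"
    and x: "x \<in> basis_words G [hw \<alpha>3 []]"
    and p: "p \<in> basis_words G [hw \<alpha>1 []] \<times> basis_words G [hw \<alpha>2 []]"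
  shows "node_overlap G \<alpha>1 \<alpha>2 \<alpha>3
      (coupling_coeff G (hw \<alpha>1 [False]) (hw \<alpha>2 [False]) (hw \<alpha>3 [False], k'))
      (coupling_coeff G (hw \<alpha>1 [True]) (hw \<alpha>2 [True]) (hw \<alpha>3 [True], k'')) x p =
    (\<Sum>k=1..tensor_multiplicity G (hw \<alpha>1 []) (hw \<alpha>2 []) (hw \<alpha>3 []).
      nine_lambda_at G \<alpha>1 \<alpha>2 \<alpha>3 [] k' k'' k *
      coupling_coeff G (hw \<alpha>1 []) (hw \<alpha>2 []) (hw \<alpha>3 [], k) x p)"
proof -
  let ?X = "coupling_coeff G (hw \<alpha>1 [False]) (hw \<alpha>2 [False]) (hw \<alpha>3 [False], k')"
  let ?Y = "coupling_coeff G (hw \<alpha>1 [True]) (hw \<alpha>2 [True]) (hw \<alpha>3 [True], k'')"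
  let ?Z = "node_overlap G \<alpha>1 \<alpha>2 \<alpha>3 ?X ?Y"
  let ?m = "tensor_multiplicity G (hw \<alpha>1 []) (hw \<alpha>2 []) (hw \<alpha>3 [])"
  let ?B = "basis_words G [hw \<alpha>3 []]" and ?P = "basis_words G [hw \<alpha>1 []] \<times> basis_words G [hw \<alpha>2 []]"
  note irr = T[THEN is_labelling_child_irreps]
  note root = T[THEN is_labelling_root_irreps]
  note c = T[THEN is_labelling_root]
  have Z: "intertwining_matrix ?B ?P (rep_mat G (hw \<alpha>3 []) g)
      (tensor_mat (rep_mat G (hw \<alpha>1 []) g) (rep_mat G (hw \<alpha>2 []) g)) ?Z" if g: "g \<in> carrier G" for g
    using coupling_coeff_intertwining[OF irr(1,2) k' g] coupling_coeff_intertwining[OF irr(1,2) k'' g]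
    by (intro node_overlap_intertwining irr c g) simp_all
  obtain r where r: "\<And>k x. k \<in> {1..?m} \<Longrightarrow> x \<in> ?B \<Longrightarrow>
      (\<Sum>p\<in>?P. cnj (coupling_coeff G (hw \<alpha>1 []) (hw \<alpha>2 []) (hw \<alpha>3 [], k) x p) * ?Z x p) = r k"
    and exp: "?Z x p = (\<Sum>k=1..?m. r k * coupling_coeff G (hw \<alpha>1 []) (hw \<alpha>2 []) (hw \<alpha>3 [], k) x p)"
    using intertwining_matrix_expand[OF root, of ?Z] Z x p by blast
  have "nine_lambda_at G \<alpha>1 \<alpha>2 \<alpha>3 [] k' k'' k = r k" if k: "k \<in> {1..?m}" for k
  proof -
    \<comment> \<open>The label used by \<open>nine_lambda\<close>, with counter 0 at the leaves. It
      agrees with \<open>\<alpha>\<close> in the weights of the children and in the full label of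
      the root, which is what \<open>node_overlap\<close> reads.\<close>
    define \<beta> where "\<beta> \<alpha> = cherry_label (hw \<alpha> [False]) (hw \<alpha> [True]) (hw \<alpha> []) (mc \<alpha> [])" for \<alpha> :: "'l labelling"
    define ks where "ks y = (if y = [False] then k' else k'')" for y :: vertex
    have b: "\<beta> \<alpha> [] = \<alpha> []" "\<beta> \<alpha> [False] = (hw \<alpha> [False], 0)" "\<beta> \<alpha> [True] = (hw \<alpha> [True], 0)" for \<alpha>
      by (simp_all add: \<beta>_def cherry_label_def)
    have kc: "(hw \<alpha>3 [], k) \<in> couplings G (hw \<alpha>1 []) (hw \<alpha>2 [])"
      using k root(3) by (auto simp: couplings_def)
    have "nine_lambda_at G \<alpha>1 \<alpha>2 \<alpha>3 [] k' k'' k = tree_recoupling G cherry (\<beta> \<alpha>1) (\<beta> \<alpha>2) k (\<beta> \<alpha>3) ks"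
      unfolding nine_lambda_at_def nine_lambda.simps \<beta>_def ks_def[abs_def] using c by simp
    also have "\<dots> = recoupling G (unshuffle (card (leaves cherry))) (Node cherry cherry)
        (join_label (\<beta> \<alpha>1) (\<beta> \<alpha>2) (hw (\<beta> \<alpha>3) [], k)) (leaf_dup cherry) (dup_label cherry (\<beta> \<alpha>1) (\<beta> \<alpha>2) (\<beta> \<alpha>3) ks)"
      unfolding tree_recoupling_def using k' k'' kc
      by (subst if_P) (auto simp: admissible_triple_def b ks_def)
    also have "\<dots> = r k"
    proof (rule recoupling_join_dup)
      show "hw (\<beta> \<alpha>3) [] \<in> irreps G" using root by (simp add: b)
      fix x assume x: "x \<in> basis_words G [hw (\<beta> \<alpha>3) []]"
      have "tree_overlap G cherry (\<beta> \<alpha>1) (\<beta> \<alpha>2) (\<beta> \<alpha>3) ks x p = ?Z x p" for p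
      proof -
        have "tree_overlap G cherry (\<beta> \<alpha>1) (\<beta> \<alpha>2) (\<beta> \<alpha>3) ks x p =
            node_overlap G (\<beta> \<alpha>1) (\<beta> \<alpha>2) (\<beta> \<alpha>3) ?X ?Y x p"
          unfolding tree_overlap_Node
          by (rule node_overlap_cong; subst tree_overlap_Leaf)
             (simp_all add: b ks_def irrep_basis irr)
        also have "\<dots> = ?Z x p" by (simp add: node_overlap_def b)
        finally show ?thesis .
      qed
      then show "(\<Sum>p\<in>basis_words G [hw (\<beta> \<alpha>1) []] \<times> basis_words G [hw (\<beta> \<alpha>2) []].
          cnj (coupling_coeff G (hw (\<beta> \<alpha>1) []) (hw (\<beta> \<alpha>2) []) (hw (\<beta> \<alpha>3) [], k) x p) *
          tree_overlap G cherry (\<beta> \<alpha>1) (\<beta> \<alpha>2) (\<beta> \<alpha>3) ks x p) = r k"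
        using r[OF k] x by (simp add: b)
    qed
    finally show ?thesis .
  qed
  then show ?thesis using exp by simp
qed

text \<open>The expansions of the children enter the bilinear \<open>node_overlap\<close>, and
  \<open>node_overlap_expand\<close> then opens the sum over the root counter. The child counters
  remain as the summation indices of \<open>tree_coeff\<close>; for a leaf the sum has one
  term.\<close>

lemma tree_overlap_expand:
  assumes "is_labelling G T \<alpha>1" "is_labelling G T \<alpha>2" "is_labelling G T \<alpha>3"
    and "\<forall>y\<in>leaves T. (hw \<alpha>3 y, ks y) \<in> couplings G (hw \<alpha>1 y) (hw \<alpha>2 y)"
    and "x \<in> basis_words G [hw \<alpha>3 []]"
    and "p \<in> basis_words G [hw \<alpha>1 []] \<times> basis_words G [hw \<alpha>2 []]"
  shows "tree_overlap G T \<alpha>1 \<alpha>2 \<alpha>3 ks x p = (\<Sum>k\<in>counter_range G T \<alpha>1 \<alpha>2 \<alpha>3 ks [].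
    tree_coeff T (counter_range G T \<alpha>1 \<alpha>2 \<alpha>3 ks) (nine_lambda_at G \<alpha>1 \<alpha>2 \<alpha>3) k *
    coupling_coeff G (hw \<alpha>1 []) (hw \<alpha>2 []) (hw \<alpha>3 [], k) x p)"
  using assms
proof (induction T arbitrary: \<alpha>1 \<alpha>2 \<alpha>3 ks x p)
  case Leaf
  then show ?case
    using Leaf.prems(1,2)[THEN is_labelling_root_irreps]
    by (simp add: tree_overlap_Leaf irrep_basis counter_range_def)
next
  case (Node l r)
  let ?E = "counter_range G (Node l r) \<alpha>1 \<alpha>2 \<alpha>3 ks" and ?f = "nine_lambda_at G \<alpha>1 \<alpha>2 \<alpha>3"
  define t where "t b = tree_coeff (if b then r else l) (\<lambda>p. ?E (b # p)) (\<lambda>p. ?f (b # p))" for b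
  define C where "C b k = coupling_coeff G (hw \<alpha>1 [b]) (hw \<alpha>2 [b]) (hw \<alpha>3 [b], k)" for b k
  let ?C = "\<lambda>k. coupling_coeff G (hw \<alpha>1 []) (hw \<alpha>2 []) (hw \<alpha>3 [], k) x p"
  note lab = Node.prems(1-3)
  have leaf: "\<forall>y\<in>leaves (if b then r else l).
      (hw \<alpha>3 (b # y), ks (b # y)) \<in> couplings G (hw \<alpha>1 (b # y)) (hw \<alpha>2 (b # y))" for b
    using Node.prems(4) by (cases b) auto
  have sub: "tree_overlap G (if b then r else l) (\<lambda>p. \<alpha>1 (b # p)) (\<lambda>p. \<alpha>2 (b # p)) (\<lambda>p. \<alpha>3 (b # p))
      (\<lambda>p. ks (b # p)) y q = (\<Sum>k\<in>?E [b]. t b k * C b k y q)"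
    if "y \<in> basis_words G [hw \<alpha>3 [b]]" "q \<in> basis_words G [hw \<alpha>1 [b]] \<times> basis_words G [hw \<alpha>2 [b]]"
    for b y q
    using lab[THEN is_labelling_child, of b] leaf[of b] that
      Node.IH(1)[of "\<lambda>p. \<alpha>1 (b # p)" "\<lambda>p. \<alpha>2 (b # p)" "\<lambda>p. \<alpha>3 (b # p)" "\<lambda>p. ks (b # p)" y q]
      Node.IH(2)[of "\<lambda>p. \<alpha>1 (b # p)" "\<lambda>p. \<alpha>2 (b # p)" "\<lambda>p. \<alpha>3 (b # p)" "\<lambda>p. ks (b # p)" y q]
    by (cases b) (simp_all add: t_def C_def counter_range_child nine_lambda_at_child)
  \<comment> \<open>Every summed child counter belongs to an actual coupling, at a leaf by
    assumption and at a node by its range; otherwise \<open>node_overlap_expand\<close> could not be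
    applied.\<close>
  have cpl: "(hw \<alpha>3 [b], k) \<in> couplings G (hw \<alpha>1 [b]) (hw \<alpha>2 [b])" if "k \<in> ?E [b]" for b k
  proof (cases "[b] \<in> leaves (Node l r)")
    case True
    then show ?thesis using that Node.prems(4) by (auto simp: counter_range_def)
  next
    case False
    then show ?thesis
      using that is_labelling_child_irreps[OF lab(3), of b] by (auto simp: counter_range_def couplings_def)
  qed
  have root: "?E [] = {1..tensor_multiplicity G (hw \<alpha>1 []) (hw \<alpha>2 []) (hw \<alpha>3 [])}"
    by (auto simp: counter_range_def)
  have "tree_overlap G (Node l r) \<alpha>1 \<alpha>2 \<alpha>3 ks x p =
      node_overlap G \<alpha>1 \<alpha>2 \<alpha>3 (\<lambda>y q. \<Sum>k\<in>?E [False]. t False k * C False k y q)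
        (\<lambda>y q. \<Sum>k\<in>?E [True]. t True k * C True k y q) x p"
    unfolding tree_overlap_Node
    using sub[where b=False] sub[where b=True] by (intro node_overlap_cong) simp_all
  also have "\<dots> = (\<Sum>k'\<in>?E [False]. \<Sum>k''\<in>?E [True]. t False k' * t True k'' *
      node_overlap G \<alpha>1 \<alpha>2 \<alpha>3 (C False k') (C True k'') x p)"
    by (rule node_overlap_sum)
  also have "\<dots> = (\<Sum>k'\<in>?E [False]. \<Sum>k''\<in>?E [True]. \<Sum>k\<in>?E [].
      t False k' * t True k'' * ?f [] k' k'' k * ?C k)"
    by (intro sum.cong refl)
       (simp add: node_overlap_expand[OF lab cpl cpl Node.prems(5,6)] C_def root sum_distrib_left mult.assoc)
  also have "\<dots> = (\<Sum>k'\<in>?E [False]. \<Sum>k\<in>?E []. \<Sum>k''\<in>?E [True].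
      t False k' * t True k'' * ?f [] k' k'' k * ?C k)"
    by (intro sum.cong refl sum.swap)
  also have "\<dots> = (\<Sum>k\<in>?E []. \<Sum>k'\<in>?E [False]. \<Sum>k''\<in>?E [True].
      t False k' * t True k'' * ?f [] k' k'' k * ?C k)"
    by (rule sum.swap)
  finally show ?case by (simp add: t_def sum_distrib_right)
qed

text \<open>Couplings with different counters are orthogonal, so contracting the expanded overlap
  with the coupling numbered \<open>k\<close> keeps exactly the term for \<open>k\<close>.\<close>

lemma tree_recoupling_eq_coeff:
  assumes T: "is_labelling G T \<alpha>1" "is_labelling G T \<alpha>2" "is_labelling G T \<alpha>3" "T \<noteq> Leaf"
    and adm: "admissible_triple G T \<alpha>1 \<alpha>2 \<alpha>3 ks k"
  shows "tree_recoupling G T \<alpha>1 \<alpha>2 k \<alpha>3 ks =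
    tree_coeff T (counter_range G T \<alpha>1 \<alpha>2 \<alpha>3 ks) (nine_lambda_at G \<alpha>1 \<alpha>2 \<alpha>3) k"
proof -
  let ?E = "counter_range G T \<alpha>1 \<alpha>2 \<alpha>3 ks"
  let ?t = "tree_coeff T ?E (nine_lambda_at G \<alpha>1 \<alpha>2 \<alpha>3)"
  let ?P = "basis_words G [hw \<alpha>1 []] \<times> basis_words G [hw \<alpha>2 []]"
  let ?C = "\<lambda>k. coupling_coeff G (hw \<alpha>1 []) (hw \<alpha>2 []) (hw \<alpha>3 [], k)"
  note root = T(1-3)[THEN is_labelling_root_irreps]
  have leaf: "\<forall>y\<in>leaves T. (hw \<alpha>3 y, ks y) \<in> couplings G (hw \<alpha>1 y) (hw \<alpha>2 y)"
    and kc: "(hw \<alpha>3 [], k) \<in> couplings G (hw \<alpha>1 []) (hw \<alpha>2 [])"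
    using adm by (simp_all add: admissible_triple_def)
  have E: "?E [] = {1..tensor_multiplicity G (hw \<alpha>1 []) (hw \<alpha>2 []) (hw \<alpha>3 [])}"
    using T(4) by (cases T) (auto simp: counter_range_def)
  have cpl: "(hw \<alpha>3 [], j) \<in> couplings G (hw \<alpha>1 []) (hw \<alpha>2 []) \<longleftrightarrow> j \<in> ?E []" for j
    using root(3) by (auto simp: E couplings_def)
  have "(\<Sum>p\<in>?P. cnj (?C k x p) * tree_overlap G T \<alpha>1 \<alpha>2 \<alpha>3 ks x p) = ?t k"
    if x: "x \<in> basis_words G [hw \<alpha>3 []]" for x
  proof -
    have "(\<Sum>p\<in>?P. cnj (?C k x p) * tree_overlap G T \<alpha>1 \<alpha>2 \<alpha>3 ks x p) =
        (\<Sum>p\<in>?P. \<Sum>j\<in>?E []. ?t j * (cnj (?C k x p) * ?C j x p))"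
      by (intro sum.cong refl) (simp add: tree_overlap_expand[OF T(1-3) leaf x] sum_distrib_left mult_ac)
    also have "\<dots> = (\<Sum>j\<in>?E []. ?t j * (\<Sum>p\<in>?P. cnj (?C k x p) * ?C j x p))"
      by (subst sum.swap) (simp only: sum_distrib_left)
    also have "\<dots> = (\<Sum>j\<in>?E []. ?t j * (if k = j then 1 else 0))"
      using coupling_coeff_orthonormal[OF root(1,2) kc _ _ , of "(hw \<alpha>3 [], _)" x x] x cpl
      by (intro sum.cong refl) simp
    also have "\<dots> = ?t k"
      using cpl[of k] kc by (simp add: E if_distrib[of "\<lambda>x. _ * x"] cong: if_cong)
    finally show ?thesis .
  qed
  from recoupling_join_dup[OF root(3) this] show ?thesis
    using adm by (simp add: tree_recoupling_def)
qed

end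

theorem theorem3p17:
  fixes G :: "('g, 'e::real_normed_vector, 'l, 'w, 'm) recoupling_data_scheme"
    and T :: btree
    and \<alpha>1 \<alpha>2 \<alpha>3 :: "'l labelling"
    and ks :: "vertex \<Rightarrow> nat"
    and k :: nat
  assumes "recoupling_setting G"
    and "coupling_tree T"
    and "is_labelling G T \<alpha>1" and "is_labelling G T \<alpha>2" and "is_labelling G T \<alpha>3"
    and "\<forall>y\<in>leaves T. ks y > 0" and "k > 0"
  shows "tree_recoupling G T \<alpha>1 \<alpha>2 k \<alpha>3 ks =
    (\<Sum>\<kappa> \<in> (\<Pi>\<^sub>E x\<in>internal_nodes T. {1..tensor_multiplicity G (hw \<alpha>1 x) (hw \<alpha>2 x) (hw \<alpha>3 x)}).
       \<Prod>x\<in>nodes T.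
         nine_lambda G
           (hw \<alpha>1 (lchild x), hw \<alpha>1 (rchild x), hw \<alpha>1 x, mc \<alpha>1 x)
           (hw \<alpha>2 (lchild x), hw \<alpha>2 (rchild x), hw \<alpha>2 x, mc \<alpha>2 x)
           (hw \<alpha>3 (lchild x), hw \<alpha>3 (rchild x), hw \<alpha>3 x, mc \<alpha>3 x)
           (counter T k ks \<kappa> (lchild x), counter T k ks \<kappa> (rchild x), counter T k ks \<kappa> x))"
proof -
  interpret recoupling_setting G by fact
  have T: "T \<noteq> Leaf" using assms(2) by (auto simp: coupling_tree_def)
  let ?f = "nine_lambda_at G \<alpha>1 \<alpha>2 \<alpha>3"
  let ?K = "\<Pi>\<^sub>E x\<in>internal_nodes T. {1..tensor_multiplicity G (hw \<alpha>1 x) (hw \<alpha>2 x) (hw \<alpha>3 x)}"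
  let ?h = "\<lambda>\<kappa>. \<Prod>x\<in>nodes T. ?f x (\<kappa> (lchild x)) (\<kappa> (rchild x)) (\<kappa> x)"
  have "tree_recoupling G T \<alpha>1 \<alpha>2 k \<alpha>3 ks = (\<Sum>\<kappa>\<in>?K. ?h (counter T k ks \<kappa>))"
  proof (cases "admissible_triple G T \<alpha>1 \<alpha>2 \<alpha>3 ks k")
    case True
    have "tree_recoupling G T \<alpha>1 \<alpha>2 k \<alpha>3 ks =
        (\<Sum>\<kappa>\<in>Pi\<^sub>E (vertices T - {[]}) (counter_range G T \<alpha>1 \<alpha>2 \<alpha>3 ks). ?h (\<kappa>([] := k)))"
      using tree_recoupling_eq_coeff[OF assms(3-5) T True] by (simp only: tree_coeff_eq_sum)
    also have "\<dots> = (\<Sum>\<kappa>\<in>?K. ?h (counter T k ks \<kappa>))"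
      unfolding counter_range_def[abs_def] by (rule sum_PiE_counter[OF T])
    finally show ?thesis .
  next
    case False
    \<comment> \<open>The left side is 0 by definition here. A nonzero product would have only
      nonzero symbols, and these give admissibility at each leaf, through its parent, and at the
      root.\<close>
    have "?h (counter T k ks \<kappa>) = 0" for \<kappa>
    proof (rule ccontr)
      assume "?h (counter T k ks \<kappa>) \<noteq> 0"
      then have "?f x (counter T k ks \<kappa> (lchild x)) (counter T k ks \<kappa> (rchild x)) (counter T k ks \<kappa> x) \<noteq> 0"
        if "x \<in> nodes T" for x
        using that finite_nodes by auto
      note nz = nine_lambda_at_nonzero[OF this]
      have root: "[] \<in> nodes T" "[] \<notin> leaves T" using T by (cases T; auto)+
      have "(hw \<alpha>3 y, ks y) \<in> couplings G (hw \<alpha>1 y) (hw \<alpha>2 y)" if y: "y \<in> leaves T" for y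
      proof -
        have "y \<noteq> []" using y root(2) by auto
        then obtain x where x: "x \<in> nodes T" "y = lchild x \<or> y = rchild x"
          using leaf_parent[OF y] by blast
        then have "(hw \<alpha>3 y, counter T k ks \<kappa> y) \<in> couplings G (hw \<alpha>1 y) (hw \<alpha>2 y)"
          using nz(1,2)[OF x(1)] by auto
        then show ?thesis using y \<open>y \<noteq> []\<close> by (simp add: counter_def)
      qed
      moreover have "(hw \<alpha>3 [], k) \<in> couplings G (hw \<alpha>1 []) (hw \<alpha>2 [])"
        using nz(3)[OF root(1)] by (simp add: counter_def)
      ultimately show False using False by (simp add: admissible_triple_def)
    qed
    then show ?thesis using False by (simp add: tree_recoupling_def)
  qed
  then show ?thesis by (simp only: nine_lambda_at_def)
qed

end
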